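(* Let $K$ be a non-empty closed convex subset of $\mathbf{R}^d$ with $K\neq\mathbf{R}^d$, let $\Omega=\mathbf{R}^d\setminus K$, and denote the Hausdorff dimension of the boundary $\Gamma=\partial\Omega$ by $d_H$. Let $c_\Omega=c\circ d_\Gamma$ where $c(s)=s^\delta(1+s)^{\delta'-\delta}$ for $s>0$, with $\delta,\delta'\geq 0$. If $p\in[1,\infty)$ and $d-d_H+(\delta\wedge\delta')-p>0$, then $$\int_\Omega c_\Omega\,|\nabla\varphi|^p\;\geq\;\int_\Omega c_\Omega\,|(\nabla d_\Gamma)\cdot(\nabla\varphi)|^p\;\geq\; a_p^{\,p}\int_\Omega c_\Omega\,d_\Gamma^{\,-p}\,|\varphi|^p$$ for all $\varphi\in C_c^1(\Omega)$, where $a_p=(d-d_H+(\delta\wedge\delta')-p)/p$.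
   Context: All functions are real-valued. $d_\Gamma(x)=\inf_{y\in\mathbf{R}^d\setminus\Omega}|x-y|$ for $x\in\Omega$ is the Euclidean distance to the boundary $\Gamma=\partial\Omega$ (it is differentiable at every point of $\Omega$ when $\Omega$ is the complement of a closed convex set). $|\nabla\varphi|=(\sum_{k=1}^d|\partial_k\varphi|^2)^{1/2}$. $\delta\wedge\delta'=\min(\delta,\delta')$. Write $\dim(K)$ for the dimension of the affine hull of $K$. The Hausdorff (Minkowski) dimension $d_H$ of $\Gamma$ equals $\dim(K)$ if $\dim(K)\in\{0,\ldots,d-1\}$ and equals $d-1$ if $\dim(K)=d$. *)

theory Defs
  imports "HOL-Analysis.Analysis"
begin

section \<open>Hausdorff measure and Hausdorff dimension\<close>

text \<open>
  The summand \<open>(diam U) ^ s\<close> with the usual conventions that the empty set contributes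
  \<open>0\<close> and that \<open>0 ^ 0 = 1\<close>. The case \<open>s = 0\<close> is separate because \<open>0 powr 0 = 0\<close> in HOL.
\<close>
definition diam_power :: "real \<Rightarrow> 'a::metric_space set \<Rightarrow> ennreal" where
  "diam_power s U =
     (if U = {} then 0 else if s = 0 then 1 else ennreal (diameter U powr s))"

text \<open>Boundedness is required because \<^const>\<open>diameter\<close> is meaningful only for bounded sets.\<close>
definition hausdorff_premeasure :: "real \<Rightarrow> real \<Rightarrow> 'a::metric_space set \<Rightarrow> ennreal" where
  "hausdorff_premeasure s \<epsilon> A =
     (INF U \<in> {U :: nat \<Rightarrow> 'a set. A \<subseteq> (\<Union>i. U i) \<and> (\<forall>i. bounded (U i) \<and> diameter (U i) \<le> \<epsilon>)}.
        (\<Sum>i. diam_power s (U i)))"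

definition hausdorff_measure :: "real \<Rightarrow> 'a::metric_space set \<Rightarrow> ennreal" where
  "hausdorff_measure s A = (SUP \<epsilon> \<in> {0<..}. hausdorff_premeasure s \<epsilon> A)"

text \<open>
  In a Euclidean space of dimension \<open>d\<close> the set below contains every \<open>s > d\<close> and is bounded
  below by \<open>0\<close>, so the real-valued infimum is the true one.
\<close>
definition hausdorff_dim :: "'a::euclidean_space set \<Rightarrow> real" where
  "hausdorff_dim A = Inf {s. 0 \<le> s \<and> hausdorff_measure s A = 0}"

section \<open>Gradients, test functions and weights\<close>

text \<open>
  The \<open>k\<close>-th component is the partial derivative in direction \<open>axis k 1\<close>, so that
  \<open>norm (grad f x)\<close> is the Euclidean norm of the vector of partial derivatives.
\<close>
definition grad :: "(real ^ 'n \<Rightarrow> real) \<Rightarrow> real ^ 'n \<Rightarrow> real ^ 'n" where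
  "grad f x = (\<chi> k. frechet_derivative f (at x) (axis k 1))"

text \<open>
  The space \<open>C\<^sub>c\<^sup>1(\<Omega>)\<close> for open \<open>\<Omega>\<close>. Functions are total in HOL; only the values on \<open>\<Omega>\<close> matter.
\<close>
definition C1_compact_support :: "(real ^ 'n) set \<Rightarrow> (real ^ 'n \<Rightarrow> real) set" where
  "C1_compact_support \<Omega> =
     {\<phi>. (\<forall>x\<in>\<Omega>. \<phi> differentiable (at x)) \<and> continuous_on \<Omega> (grad \<phi>) \<and>
         compact (closure {x\<in>\<Omega>. \<phi> x \<noteq> 0}) \<and> closure {x\<in>\<Omega>. \<phi> x \<noteq> 0} \<subseteq> \<Omega>}"

definition boundary_dist :: "(real ^ 'n) set \<Rightarrow> real ^ 'n \<Rightarrow> real" where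
  "boundary_dist \<Omega> x = infdist x (UNIV - \<Omega>)"

definition weight :: "real \<Rightarrow> real \<Rightarrow> real \<Rightarrow> real" where
  "weight \<delta> \<delta>' s = s powr \<delta> * (1 + s) powr (\<delta>' - \<delta>)"

end

theory Submission
  imports Defs
begin

text \<open>
  The proof transports the functions along the rays that are normal to \<open>K\<close>. Let \<open>proj\<close> be the
  nearest point projection onto \<open>K\<close> and let \<open>ray t x = proj x + t * (x - proj x)\<close>. The maps \<open>ray t\<close>
  for \<open>t > 0\<close> are bijections of \<open>\<Omega>\<close> with \<open>ray s (ray t x) = ray (s * t) x\<close>, they multiply the distance
  to \<open>K\<close> by \<open>t\<close>, and \<open>\<phi> (ray (exp s) x)\<close> has the derivative \<open>G (ray (exp s) x)\<close> in \<open>s\<close>, where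
  \<open>G = d\<^sub>\<Gamma> * (grad d\<^sub>\<Gamma> \<bullet> grad \<phi>)\<close>. As \<open>\<phi>\<close> vanishes far out on each ray,
  \<open>\<bar>\<phi> x\<bar>\<close> is at most the integral of \<open>\<bar>G (ray (exp s) x)\<bar>\<close> over \<open>s \<ge> 0\<close>. Jensen's inequality for the
  exponential distribution, Tonelli's theorem and the growth of the weight
  (\<open>weight_scale\<close>) reduce the Hardy inequality to one geometric estimate
  (\<open>nn_integral_ray_le\<close>): for \<open>t \<ge> 1\<close>, composing a nonnegative function with \<open>ray t\<close> multiplies
  its integral over \<open>\<Omega>\<close> by at most \<open>(1 / t) ^ k\<close>, where \<open>k \<ge> d - d\<^sub>H\<close>. The computation is carried out in
  \<open>radial_hardy\<close>.

  For smooth data the geometric estimate says that the Jacobian determinant of \<open>ray t\<close> is at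
  least \<open>t ^ k\<close>. The derivative of \<open>proj\<close> is symmetric with eigenvalues between \<open>0\<close> and \<open>1\<close>, hence
  \<open>ray t\<close> expands every direction at least by the factor \<open>1\<close>, and exactly by the factor \<open>t\<close> the directions
  in which \<open>proj\<close> does not move. These include the gradient of the distance and all directions
  orthogonal to the affine hull of \<open>K\<close>. Since \<open>proj\<close> need not be differentiable everywhere,
  the inverse map \<open>ray (1 / t)\<close> is estimated instead: it maps small balls into slightly enlarged
  ellipsoids (\<open>stretched_contraction_bound\<close>), and the covering theorem of Vitali gives the bound for
  the volumes of images of open sets (\<open>emeasure_ray_image_open_le\<close>).

  The Hausdorff dimension enters only through the inequality \<open>d - k \<le> d\<^sub>H\<close>. If \<open>K\<close> has interior points,
  then \<open>k = 1\<close>, and otherwise \<open>k\<close> is the codimension of the affine hull of \<open>K\<close>, in which case \<open>K\<close>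
  is its own boundary. In both cases the boundary, thickened in \<open>k\<close> coordinate directions, contains a
  ball, which forces its dimension to be at least \<open>d - k\<close> (\<open>hausdorff_dim_lower_bound\<close>).
\<close>

section \<open>Lower bounds for the Hausdorff dimension\<close>

lemma hausdorff_measure_zeroI:
  fixes A :: "'a::metric_space set"
  assumes "\<And>\<epsilon> \<eta>. 0 < \<epsilon> \<Longrightarrow> 0 < \<eta> \<Longrightarrow> \<exists>U :: nat \<Rightarrow> 'a set. A \<subseteq> (\<Union>i. U i) \<and>
      (\<forall>i. bounded (U i) \<and> diameter (U i) \<le> \<epsilon>) \<and> (\<Sum>i. diam_power s (U i)) \<le> ennreal \<eta>"
  shows "hausdorff_measure s A = 0"
proof -
  have "hausdorff_premeasure s \<epsilon> A \<le> 0" if "0 < \<epsilon>" for \<epsilon>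
  proof (rule ennreal_le_epsilon)
    fix \<eta> :: real assume "0 < \<eta>"
    from assms[OF that this] obtain U :: "nat \<Rightarrow> 'a set" where
      U: "A \<subseteq> (\<Union>i. U i)" "\<forall>i. bounded (U i) \<and> diameter (U i) \<le> \<epsilon>"
        "(\<Sum>i. diam_power s (U i)) \<le> ennreal \<eta>" by blast
    have "hausdorff_premeasure s \<epsilon> A \<le> (\<Sum>i. diam_power s (U i))"
      unfolding hausdorff_premeasure_def using U by (intro INF_lower) auto
    with U(3) show "hausdorff_premeasure s \<epsilon> A \<le> 0 + ennreal \<eta>" by simp
  qed
  then show ?thesis
    unfolding hausdorff_measure_def by (intro antisym SUP_least) auto
qed

text \<open>
  The cells of a grid of mesh \<open>1 / N\<close> that meet a cube of side \<open>2 * j\<close>; the crude bound on their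
  diameter compares the Euclidean norm with the sum of the absolute values of the coordinates.
\<close>
lemma grid_cover:
  fixes j N :: nat
  assumes "0 < N"
  obtains F :: "'a::euclidean_space set set" where
    "finite F" "card F \<le> (2 * j * N + 1) ^ DIM('a)"
    "cbox (- real j *\<^sub>R One) (real j *\<^sub>R One) \<subseteq> \<Union>F"
    "\<And>V. V \<in> F \<Longrightarrow> bounded V \<and> diameter V \<le> DIM('a) / N"
proof
  define cell :: "('a \<Rightarrow> int) \<Rightarrow> 'a set" where
    "cell f = {x. \<forall>b\<in>Basis. f b \<le> N * (x \<bullet> b) \<and> N * (x \<bullet> b) \<le> f b + 1}" for f
  let ?I = "{- int (j * N) .. int (j * N)}"
  let ?F = "cell ` (PiE Basis (\<lambda>_. ?I))"
  show "finite ?F" by (intro finite_imageI finite_PiE) auto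
  have "card ?F \<le> card (PiE (Basis :: 'a set) (\<lambda>_. ?I))"
    by (intro card_image_le finite_PiE) auto
  also have "\<dots> = (2 * j * N + 1) ^ DIM('a)"
    by (simp add: card_PiE nat_add_distrib nat_mult_distrib)
      (simp add: algebra_simps flip: of_nat_mult)
  finally show "card ?F \<le> (2 * j * N + 1) ^ DIM('a)" .
  show "cbox (- real j *\<^sub>R One) (real j *\<^sub>R One) \<subseteq> \<Union>?F"
  proof
    fix x :: 'a assume x: "x \<in> cbox (- real j *\<^sub>R One) (real j *\<^sub>R One)"
    define f where "f = restrict (\<lambda>b. \<lfloor>N * (x \<bullet> b)\<rfloor>) (Basis :: 'a set)"
    have "f b \<in> ?I" if "b \<in> Basis" for b
    proof -
      have "- real j \<le> x \<bullet> b" "x \<bullet> b \<le> j" using x that by (auto simp: mem_box)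
      then have "N * (- real j) \<le> N * (x \<bullet> b)" "N * (x \<bullet> b) \<le> N * real j"
        by (intro mult_left_mono; simp)+
      then show ?thesis using that unfolding f_def
        by (auto simp: le_floor_iff floor_le_iff mult.commute)
    qed
    then have "f \<in> PiE Basis (\<lambda>_. ?I)" by (auto simp: f_def PiE_iff)
    moreover have "x \<in> cell f" unfolding cell_def f_def
      by (simp add: less_imp_le[OF floor_correct[THEN conjunct2]] del: of_int_add)
    ultimately show "x \<in> \<Union>?F" by blast
  qed
  fix V assume "V \<in> ?F"
  then obtain f where V: "V = cell f" by blast
  have d: "dist x y \<le> DIM('a) / N" if "x \<in> V" "y \<in> V" for x y
  proof -
    have "\<bar>(x - y) \<bullet> b\<bar> \<le> 1 / N" if b: "b \<in> Basis" for b
    proof -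
      have "N * (x \<bullet> b) - N * (y \<bullet> b) \<le> 1" "N * (y \<bullet> b) - N * (x \<bullet> b) \<le> 1"
        using \<open>x \<in> V\<close> \<open>y \<in> V\<close> b unfolding V cell_def by fastforce+
      then have "N * \<bar>(x - y) \<bullet> b\<bar> \<le> 1"
        by (auto simp: inner_diff_left abs_if algebra_simps)
      then show ?thesis using assms by (simp add: field_simps)
    qed
    then have "(\<Sum>b\<in>Basis. \<bar>(x - y) \<bullet> b\<bar>) \<le> (\<Sum>b\<in>(Basis :: 'a set). 1 / N)"
      by (intro sum_mono)
    with norm_le_l1[of "x - y"] show ?thesis by (simp add: dist_norm)
  qed
  moreover have "diameter V \<le> DIM('a) / N"
    using d by (intro diameter_le) (auto simp: dist_norm)
  moreover have "bounded V"
    using d unfolding bounded_two_points by blast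
  ultimately show "bounded V \<and> diameter V \<le> DIM('a) / N" by blast
qed

text \<open>
  About \<open>N ^ d\<close> cells of diameter about \<open>1 / N\<close> cover a cube, and the sum of the \<open>(d + 1)\<close>-st powers
  of their diameters is of order \<open>1 / N\<close>. Covering the cube of side \<open>2 * j\<close> with total at most
  \<open>\<eta> / 2 ^ Suc j\<close>, for all \<open>j\<close> simultaneously, takes care of the whole space. The lemma serves to
  show that the set whose infimum is \<^const>\<open>hausdorff_dim\<close> is never empty: the infimum of the empty
  set of reals is an unspecified number.
\<close>
lemma hausdorff_measure_above_dimension:
  fixes A :: "'a::euclidean_space set"
  shows "hausdorff_measure (DIM('a) + 1) A = 0"
proof (rule hausdorff_measure_zeroI)
  fix \<epsilon> \<eta> :: real assume pos: "0 < \<epsilon>" "0 < \<eta>"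
  let ?d = "DIM('a)" and ?p = "diam_power (real DIM('a) + 1) :: 'a set \<Rightarrow> ennreal"
  have "\<exists>U :: nat \<Rightarrow> 'a set. cbox (- real j *\<^sub>R One) (real j *\<^sub>R One) \<subseteq> (\<Union>i. U i) \<and>
      (\<forall>i. bounded (U i) \<and> diameter (U i) \<le> \<epsilon>) \<and> (\<Sum>i. ?p (U i)) \<le> ennreal (\<eta> * (1/2) ^ Suc j)"
    for j :: nat
  proof -
    define q where "q = real (2 * j + 1) ^ ?d * real ?d ^ Suc ?d"
    define \<eta>' where "\<eta>' = \<eta> * (1/2) ^ Suc j"
    have \<eta>': "0 < \<eta>'" using pos by (simp add: \<eta>'_def)
    obtain N0 :: nat where N0: "max (?d / \<epsilon>) (q / \<eta>') < N0" using reals_Archimedean2 by blast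
    define N where "N = Suc N0"
    have N: "0 < N" "?d / \<epsilon> \<le> N" "q / \<eta>' \<le> N" using N0 by (auto simp: N_def)
    obtain F :: "'a set set" where F: "finite F" "card F \<le> (2 * j * N + 1) ^ ?d"
      "cbox (- real j *\<^sub>R One) (real j *\<^sub>R One) \<subseteq> \<Union>F"
      "\<And>V. V \<in> F \<Longrightarrow> bounded V \<and> diameter V \<le> ?d / N"
      using grid_cover[OF N(1)] by blast
    obtain h where h: "bij_betw h {..<card F} F"
      using F(1) ex_bij_betw_nat_finite by (metis atLeast0LessThan)
    define U where "U i = (if i < card F then h i else {})" for i
    have hF: "h i \<in> F" if "i < card F" for i using h that by (auto simp: bij_betw_def)
    have "?p V \<le> ennreal ((?d / N) ^ Suc ?d)" if "V \<in> F" for V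
    proof (cases "V = {}")
      case False
      have "diameter V powr (real ?d + 1) \<le> (?d / N) powr (real ?d + 1)"
        using F(4)[OF that] by (intro powr_mono2) (auto simp: diameter_ge_0)
      also have "\<dots> = (?d / N) ^ Suc ?d"
        using N(1) by (subst powr_realpow[symmetric]) (auto simp: add.commute)
      finally show ?thesis using False by (auto simp: diam_power_def intro!: ennreal_leI)
    qed (simp add: diam_power_def)
    then have "(\<Sum>V\<in>F. ?p V) \<le> (\<Sum>V\<in>F. ennreal ((?d / N) ^ Suc ?d))" by (rule sum_mono)
    also have "\<dots> = ennreal (card F * (?d / N) ^ Suc ?d)"
      by (simp add: ennreal_of_nat_eq_real_of_nat ennreal_mult'' del: power_Suc)
    also have "\<dots> \<le> ennreal \<eta>'"
    proof (rule ennreal_leI)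
      have "2 * j * N + 1 \<le> (2 * j + 1) * N" using N(1) by (simp add: algebra_simps)
      then have "card F \<le> ((2 * j + 1) * N) ^ ?d"
        using F(2) power_mono[of "2 * j * N + 1" "(2 * j + 1) * N" ?d] by linarith
      then have "real (card F) \<le> (real (2 * j + 1) * N) ^ ?d"
        by (metis of_nat_le_iff of_nat_mult of_nat_power)
      then have "card F * (?d / N) ^ Suc ?d \<le> (real (2 * j + 1) * N) ^ ?d * (?d / N) ^ Suc ?d"
        by (intro mult_right_mono) auto
      also have "\<dots> = q / N"
        using N(1) by (simp add: q_def power_mult_distrib power_divide)
      also have "\<dots> \<le> \<eta>'" using N(1,3) \<eta>' by (simp add: field_simps)
      finally show "card F * (?d / N) ^ Suc ?d \<le> \<eta>'" .
    qed
    finally have sumF: "(\<Sum>V\<in>F. ?p V) \<le> ennreal \<eta>'" .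
    have "(\<Sum>i. ?p (U i)) = (\<Sum>i<card F. ?p (U i))"
      by (rule suminf_finite) (auto simp: U_def diam_power_def)
    also have "\<dots> = (\<Sum>i<card F. ?p (h i))" by (intro sum.cong) (auto simp: U_def)
    also have "\<dots> = (\<Sum>V\<in>F. ?p V)" by (rule sum.reindex_bij_betw[OF h])
    finally have "(\<Sum>i. ?p (U i)) \<le> ennreal \<eta>'" using sumF by simp
    moreover have "cbox (- real j *\<^sub>R One) (real j *\<^sub>R One) \<subseteq> (\<Union>i. U i)"
    proof (rule order.trans[OF F(3)], rule subsetI)
      fix x assume "x \<in> \<Union>F"
      then obtain i where "i < card F" "x \<in> h i" using h by (auto simp: bij_betw_def)
      then have "x \<in> U i" by (simp add: U_def)
      then show "x \<in> (\<Union>i. U i)" by blast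
    qed
    moreover have "bounded (U i) \<and> diameter (U i) \<le> \<epsilon>" for i
    proof (cases "i < card F")
      case True
      have "?d / N \<le> \<epsilon>" using N pos by (simp add: field_simps)
      then show ?thesis using F(4)[OF hF[OF True]] True by (auto simp: U_def)
    qed (use pos in \<open>simp add: U_def diameter_empty\<close>)
    ultimately show ?thesis
      unfolding \<eta>'_def by (intro exI[of _ U]) simp
  qed
  then obtain U :: "nat \<Rightarrow> nat \<Rightarrow> 'a set" where
    U: "\<And>j. cbox (- real j *\<^sub>R One) (real j *\<^sub>R One) \<subseteq> (\<Union>i. U j i)"
      "\<And>j i. bounded (U j i)" "\<And>j i. diameter (U j i) \<le> \<epsilon>"
      "\<And>j. (\<Sum>i. ?p (U j i)) \<le> ennreal (\<eta> * (1/2) ^ Suc j)" by metis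
  define W where "W i = case_prod U (prod_decode i)" for i
  have "A \<subseteq> (\<Union>i. W i)"
  proof
    fix x :: 'a
    obtain j :: nat where j: "norm x \<le> j" using real_arch_simple by blast
    have "x \<in> cbox (- real j *\<^sub>R One) (real j *\<^sub>R One)"
      unfolding mem_box using order.trans[OF Basis_le_norm j] by (fastforce simp: abs_le_iff)
    then obtain i where "x \<in> U j i" using U(1) by blast
    then have "x \<in> W (prod_encode (j, i))" by (simp add: W_def)
    then show "x \<in> (\<Union>i. W i)" by blast
  qed
  moreover have "\<forall>i. bounded (W i) \<and> diameter (W i) \<le> \<epsilon>"
    using U(2,3) by (auto simp: W_def split: prod.split)
  moreover have "(\<Sum>i. ?p (W i)) \<le> ennreal \<eta>"
  proof -
    have "(\<Sum>i. ?p (W i)) = (\<Sum>j. \<Sum>i. ?p (U j i))"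
      unfolding W_def
      using suminf_ennreal_2dimen[of "\<lambda>m. \<Sum>n. ?p (U m n)" "\<lambda>x. ?p (case_prod U x)"] by simp
    also have "\<dots> \<le> (\<Sum>j. ennreal (\<eta> * (1/2) ^ Suc j))"
      by (intro suminf_le U) auto
    also have "\<dots> = ennreal \<eta>"
    proof (rule suminf_ennreal_eq)
      show "(\<lambda>j. \<eta> * (1/2) ^ Suc j) sums \<eta>" using sums_mult[OF power_half_series, of \<eta>] by simp
    qed (use pos in auto)
    finally show ?thesis .
  qed
  ultimately show "\<exists>U :: nat \<Rightarrow> 'a set. A \<subseteq> (\<Union>i. U i) \<and>
      (\<forall>i. bounded (U i) \<and> diameter (U i) \<le> \<epsilon>) \<and>
      (\<Sum>i. diam_power (DIM('a) + 1) (U i)) \<le> ennreal \<eta>"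
    by (intro exI[of _ W]) (auto simp: add.commute)
qed

text \<open>
  A mass distribution principle with Lebesgue measure on a thickening of \<open>A\<close> as the mass. If \<open>A\<close>, thickened in the directions of a set \<open>C\<close> of coordinate vectors, contains a ball of
  radius \<open>r\<close>, then a cover of \<open>A\<close> by sets \<open>U\<^sub>i\<close> induces a cover of the ball by boxes that have side
  \<open>2 * r\<close> in the directions of \<open>C\<close> and \<open>2 * diameter U\<^sub>i\<close> in the other \<open>m\<close> directions. Comparing
  volumes bounds the sum of \<open>diameter U\<^sub>i ^ m\<close> from below by a positive constant. Coordinate
  directions suffice for the applications, and they make the boxes parallel to the axes.
\<close>
lemma hausdorff_dim_lower_bound:
  fixes A :: "'a::euclidean_space set"
  assumes C: "C \<subseteq> Basis" and r: "0 < r"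
    and thick: "ball x0 r \<subseteq> {y + z | y z. y \<in> A \<and> z \<in> span C}"
  shows "real DIM('a) - card C \<le> hausdorff_dim A"
proof -
  define m where "m = card (Basis - C)"
  have finC: "finite C" using C finite_Basis finite_subset by blast
  have m: "real m = real DIM('a) - card C"
    unfolding m_def using C finC by (simp add: card_Diff_subset card_mono of_nat_diff)
  define M where "M = (2 * r) ^ card C * 2 ^ m"
  have M: "0 < M" using r by (simp add: M_def)
  define \<kappa> where "\<kappa> = ennreal (1 / M) * emeasure lborel (ball x0 r)"
  have "0 < emeasure lborel (ball x0 r)"
    using content_ball_pos[OF r, of x0] by (simp add: measure_def enn2real_positive_iff)
  then have \<kappa>: "0 < \<kappa>" using M by (simp add: \<kappa>_def ennreal_zero_less_mult_iff)
  have "\<kappa> \<le> hausdorff_premeasure s 1 A" if s: "0 \<le> s" "s < real m" for s :: real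
    unfolding hausdorff_premeasure_def
  proof (rule INF_greatest)
    fix U :: "nat \<Rightarrow> 'a set"
    assume "U \<in> {U. A \<subseteq> (\<Union>i. U i) \<and> (\<forall>i. bounded (U i) \<and> diameter (U i) \<le> 1)}"
    then have U: "A \<subseteq> (\<Union>i. U i)" "\<And>i. bounded (U i)" "\<And>i. diameter (U i) \<le> 1" by auto
    define B where "B i = (if U i = {} then {} else
       cbox (\<Sum>b\<in>Basis. (if b \<in> C then x0 \<bullet> b - r else (SOME y. y \<in> U i) \<bullet> b - diameter (U i)) *\<^sub>R b)
            (\<Sum>b\<in>Basis. (if b \<in> C then x0 \<bullet> b + r else (SOME y. y \<in> U i) \<bullet> b + diameter (U i)) *\<^sub>R b))" for i
    \<comment> \<open>Diameters are at most \<open>1\<close>, so \<open>s < m\<close> gives \<open>?D ^ m \<le> ?D powr s\<close>; the conventions for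
      \<open>0 ^ 0\<close> in \<^const>\<open>diam_power\<close> require separate treatment of \<open>s = 0\<close> and \<open>?D = 0\<close>.\<close>
    have vol: "ennreal (1 / M) * emeasure lborel (B i) \<le> diam_power s (U i)" for i
    proof (cases "U i = {}")
      case False
      let ?D = "diameter (U i)"
      have D: "0 \<le> ?D" "?D \<le> 1" using U by (auto simp: diameter_ge_0)
      have "emeasure lborel (B i) = ennreal (\<Prod>b\<in>Basis. if b \<in> C then 2 * r else 2 * ?D)"
      proof -
        have "B i = cbox (\<Sum>b\<in>Basis. (if b \<in> C then x0 \<bullet> b - r else (SOME y. y \<in> U i) \<bullet> b - ?D) *\<^sub>R b)
            (\<Sum>b\<in>Basis. (if b \<in> C then x0 \<bullet> b + r else (SOME y. y \<in> U i) \<bullet> b + ?D) *\<^sub>R b)" (is "_ = cbox ?l ?u")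
          using False by (simp add: B_def)
        moreover have "?l \<bullet> b \<le> ?u \<bullet> b" if "b \<in> Basis" for b using that r D by simp
        moreover have "(?u - ?l) \<bullet> b = (if b \<in> C then 2 * r else 2 * ?D)" if "b \<in> Basis" for b
          using that by (simp add: inner_diff_left)
        ultimately show ?thesis by (simp add: emeasure_lborel_cbox)
      qed
      also have "(\<Prod>b\<in>Basis. if b \<in> C then 2 * r else 2 * ?D) = (2 * r) ^ card C * (2 * ?D) ^ m"
        using C by (simp add: prod.If_cases m_def Int_absorb1 Diff_eq)
      finally have "ennreal (1 / M) * emeasure lborel (B i) = ennreal (?D ^ m)"
        using M D r by (simp add: M_def power_mult_distrib flip: ennreal_mult')
      also have "\<dots> \<le> diam_power s (U i)"
      proof (cases "s = 0 \<or> ?D = 0")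
        case True
        have "?D ^ m \<le> 1" using D by (simp add: power_le_one)
        with True False s show ?thesis by (auto simp: diam_power_def power_0_left ennreal_le_1)
      next
        case False
        then have "?D ^ m = ?D powr m" using D by (simp add: powr_realpow)
        also have "\<dots> \<le> ?D powr s" using D s False by (intro powr_mono') auto
        finally show ?thesis using \<open>U i \<noteq> {}\<close> False by (auto simp: diam_power_def intro!: ennreal_leI)
      qed
      finally show ?thesis .
    qed (simp add: B_def)
    have "ball x0 r \<subseteq> (\<Union>i. B i)"
    proof
      fix x assume x: "x \<in> ball x0 r"
      with thick obtain y z where yz: "x = y + z" "y \<in> A" "z \<in> span C" by blast
      with U obtain i where i: "y \<in> U i" by blast
      define y0 where "y0 = (SOME y. y \<in> U i)"
      have y0: "y0 \<in> U i" unfolding y0_def using i by (rule someI)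
      have "\<bar>x \<bullet> b - x0 \<bullet> b\<bar> \<le> r" if "b \<in> Basis" for b
        using Basis_le_norm[OF that, of "x - x0"] x by (simp add: dist_norm norm_minus_commute inner_diff_left)
      moreover have "\<bar>x \<bullet> b - y0 \<bullet> b\<bar> \<le> diameter (U i)" if b: "b \<in> Basis" "b \<notin> C" for b
      proof -
        have "orthogonal b z"
          
        proof (rule orthogonal_to_span[OF yz(3)])
          fix c assume "c \<in> C"
          then show "orthogonal b c"
            using b C by (auto simp: orthogonal_def inner_Basis)
        qed
        then have "x \<bullet> b - y0 \<bullet> b = (y - y0) \<bullet> b"
          by (simp add: yz orthogonal_def inner_commute[of _ b] inner_diff_right inner_add_right)
        moreover have "dist y y0 \<le> diameter (U i)"
          using diameter_bounded_bound[OF U(2) i y0] .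
        ultimately show ?thesis
          using Basis_le_norm[OF b(1), of "y - y0"] by (simp add: dist_norm)
      qed
      ultimately have "x \<in> B i"
        using i unfolding B_def y0_def by (auto simp: mem_box abs_diff_le_iff)
      then show "x \<in> (\<Union>i. B i)" by blast
    qed
    then have "emeasure lborel (ball x0 r) \<le> emeasure lborel (\<Union>i. B i)"
      by (intro emeasure_mono) (auto simp: B_def)
    also have "\<dots> \<le> (\<Sum>i. emeasure lborel (B i))"
      by (intro emeasure_subadditive_countably) (auto simp: B_def)
    finally have "\<kappa> \<le> ennreal (1 / M) * (\<Sum>i. emeasure lborel (B i))"
      unfolding \<kappa>_def by (rule mult_left_mono) simp
    also have "\<dots> = (\<Sum>i. ennreal (1 / M) * emeasure lborel (B i))" by simp
    also have "\<dots> \<le> (\<Sum>i. diam_power s (U i))" by (intro suminf_le vol) auto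
    finally show "\<kappa> \<le> (\<Sum>i. diam_power s (U i))" .
  qed
  then have "\<kappa> \<le> hausdorff_measure s A" if "0 \<le> s" "s < real m" for s :: real
    unfolding hausdorff_measure_def using that by (intro SUP_upper2[of 1]) auto
  then have "real m \<le> s" if "0 \<le> s" "hausdorff_measure s A = 0" for s :: real
    using \<kappa> that by (metis leD not_le)
  then have lower: "real m \<le> s" if "s \<in> {s. 0 \<le> s \<and> hausdorff_measure s A = 0}" for s
    using that by blast
  have "real DIM('a) + 1 \<in> {s. 0 \<le> s \<and> hausdorff_measure s A = 0}"
    using hausdorff_measure_above_dimension[of A] by (simp add: add.commute)
  then have "real m \<le> Inf {s. 0 \<le> s \<and> hausdorff_measure s A = 0}"
    by (intro cInf_greatest lower) (rule ex_in_conv[THEN iffD1], rule exI)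
  then have "real m \<le> hausdorff_dim A" unfolding hausdorff_dim_def .
  then show ?thesis using m by simp
qed

text \<open>
  By the exchange lemma a basis of the direction space of \<open>K\<close> can be completed to a basis of the
  whole space by coordinate vectors. Thickening \<open>K\<close> in these coordinate directions gives a convex set
  of full dimension, which therefore contains a ball.
\<close>
lemma hausdorff_dim_convex_lower_bound:
  fixes K :: "'a::euclidean_space set"
  assumes "convex K" "aff_dim K = int m"
  shows "real m \<le> hausdorff_dim K"
proof -
  obtain a where a: "a \<in> K" using assms(2) by (cases "K = {}") auto
  define L where "L = (\<lambda>x. x - a) ` K"
  have dimL: "dim L = m"
    using aff_dim_eq_dim_subtract[of a K] a assms(2) by (simp add: L_def hull_inc)
  obtain B where B: "B \<subseteq> L" "independent B" "L \<subseteq> span B" "card B = m"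
    using basis_exists[of L] unfolding dimL by blast
  obtain D where D: "B \<subseteq> D" "D \<subseteq> B \<union> Basis" "independent D" "B \<union> Basis \<subseteq> span D"
    using maximal_independent_subset_extend[of B "B \<union> Basis"] B(2) by auto
  define C where "C = D - B"
  have C: "C \<subseteq> Basis" using D by (auto simp: C_def)
  have "span D = UNIV"
    using span_minimal[of Basis "span D"] D(4) by (auto simp: span_Basis)
  then have "card D = DIM('a)"
    using dim_span_eq_card_independent[OF D(3)] by simp
  then have cardC: "card C = DIM('a) - m"
    using B(4) D(1) independent_imp_finite[OF B(2)] by (simp add: C_def card_Diff_subset)
  have mle: "m \<le> DIM('a)" using dimL dim_subset_UNIV[of L] by simp
  define T where "T = {y + z | y z. y \<in> K \<and> z \<in> span C}"
  have convT: "convex T"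
  proof -
    have "T = (\<Union>y\<in>K. \<Union>z\<in>span C. {y + z})" by (auto simp: T_def)
    then show ?thesis
      using convex_sums[OF assms(1) subspace_imp_convex[OF subspace_span, of C]] by simp
  qed
  have KT: "y \<in> T" if "y \<in> K" for y
    unfolding T_def using that span_zero[of C] by (intro CollectI exI[of _ y] exI[of _ 0]) simp
  have "aff_dim T = int (dim ((\<lambda>x. x - a) ` T))"
    using a by (intro aff_dim_eq_dim_subtract hull_inc KT)
  moreover have "D \<subseteq> (\<lambda>x. x - a) ` T"
  proof
    fix v assume v: "v \<in> D"
    have "v + a \<in> T"
    proof (cases "v \<in> B")
      case True
      then have "v + a \<in> K" using B(1) by (auto simp: L_def)
      then show ?thesis by (rule KT)
    next
      case False
      then have "v \<in> span C" using v by (auto simp: C_def span_base)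
      then show ?thesis unfolding T_def using a by (auto simp: add.commute)
    qed
    then show "v \<in> (\<lambda>x. x - a) ` T" by (intro image_eqI[of _ _ "v + a"]) auto
  qed
  then have "dim ((\<lambda>x. x - a) ` T) = DIM('a)"
    using dim_subset[of D "(\<lambda>x. x - a) ` T"] dim_subset_UNIV[of "(\<lambda>x. x - a) ` T"]
      \<open>card D = DIM('a)\<close> D(3) by (simp add: dim_eq_card_independent)
  ultimately have "affine hull T = UNIV" by (simp add: aff_dim_eq_full)
  then have "interior T \<noteq> {}"
    using convT KT[OF a] rel_interior_interior[of T] rel_interior_eq_empty[of T] by auto
  then obtain x0 r where "0 < r" "ball x0 r \<subseteq> T"
    by (metis ex_in_conv mem_interior)
  then have "real DIM('a) - card C \<le> hausdorff_dim K"
    using hausdorff_dim_lower_bound[OF C] unfolding T_def by blast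
  with cardC mle show ?thesis by (simp add: of_nat_diff)
qed

text \<open>
  A convex set that contains a full line in each coordinate direction through one of its points is
  the whole space. So a proper closed convex set with an interior point \<open>x\<close> is left by the line
  through \<open>x\<close> in some coordinate direction \<open>e\<close>, and by all parallel lines close to it. Each of them
  meets the frontier, hence thickening the frontier in the single direction \<open>e\<close> covers a ball.
\<close>
lemma hausdorff_dim_frontier_convex_body:
  fixes K :: "'a::euclidean_space set"
  assumes "closed K" "convex K" "interior K \<noteq> {}" "K \<noteq> UNIV"
  shows "real DIM('a) - 1 \<le> hausdorff_dim (frontier K)"
proof -
  obtain x r where r: "0 < r" "ball x r \<subseteq> K" using assms(3) by (metis ex_in_conv mem_interior)
  have "\<exists>e\<in>Basis. \<exists>t. x + t *\<^sub>R e \<notin> K"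
  proof (rule ccontr)
    assume "\<not> ?thesis"
    then have lines: "x + t *\<^sub>R e \<in> K" if "e \<in> Basis" for e t using that by blast
    have "y \<in> K" for y
    proof -
      \<comment> \<open>\<open>y\<close> is the mean of points on the lines.\<close>
      have "(\<Sum>e\<in>Basis. (1 / DIM('a)) *\<^sub>R (x + (DIM('a) * ((y - x) \<bullet> e)) *\<^sub>R e)) \<in> K"
        by (intro convex_sum assms lines) auto
      also have "(\<Sum>e\<in>Basis. (1 / DIM('a)) *\<^sub>R (x + (DIM('a) * ((y - x) \<bullet> e)) *\<^sub>R e)) = x + (y - x)"
        by (simp add: scaleR_add_right sum.distrib euclidean_representation sum_constant_scaleR)
      finally show ?thesis by simp
    qed
    with assms(4) show False by blast
  qed
  then obtain e t where e: "e \<in> Basis" "x + t *\<^sub>R e \<notin> K" by blast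
  then obtain r' where r': "0 < r'" "ball (x + t *\<^sub>R e) r' \<inter> K = {}"
    using open_contains_ball[THEN iffD1, OF open_Compl[OF assms(1)]] by blast
  define \<rho> where "\<rho> = min r r'"
  have "ball x \<rho> \<subseteq> {y + z | y z. y \<in> frontier K \<and> z \<in> span {e}}"
  proof
    fix u assume u: "u \<in> ball x \<rho>"
    let ?S = "closed_segment u (u + t *\<^sub>R e)"
    have "u \<in> K" using u r by (auto simp: \<rho>_def)
    moreover have "u + t *\<^sub>R e \<in> ball (x + t *\<^sub>R e) r'" using u by (simp add: \<rho>_def dist_norm)
    then have "u + t *\<^sub>R e \<notin> K" using r' by blast
    ultimately have "?S \<inter> frontier K \<noteq> {}"
      by (intro connected_Int_frontier) auto
    then obtain s where "u + s *\<^sub>R (t *\<^sub>R e) \<in> frontier K"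
      unfolding closed_segment_def by (auto simp: algebra_simps)
    moreover have "u = (u + s *\<^sub>R (t *\<^sub>R e)) + (- (s * t)) *\<^sub>R e" by simp
    moreover have "(- (s * t)) *\<^sub>R e \<in> span {e}" by (intro span_scale span_base) simp
    ultimately show "u \<in> {y + z | y z. y \<in> frontier K \<and> z \<in> span {e}}" by blast
  qed
  moreover have "0 < \<rho>" using r r' by (simp add: \<rho>_def)
  ultimately show ?thesis using hausdorff_dim_lower_bound[of "{e}" \<rho> x "frontier K"] e by auto
qed

section \<open>Lebesgue measure of ellipsoids\<close>

text \<open>
  Uniqueness of Haar measure, by the classical computation with Tonelli's theorem: evaluate the
  double integral of \<open>indicator A x * indicator B y\<close> by the substitution \<open>y \<mapsto> x + y\<close> in the integral
  over \<open>y\<close> and, with the order of integration reversed, \<open>x \<mapsto> x - y\<close> in the integral over \<open>x\<close>. The reflection invariance of \<^const>\<open>lborel\<close>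
  turns the remaining inner integral into the measure of \<open>A\<close>.
\<close>
lemma translation_invariant_proportional_lborel:
  fixes M :: "'a::euclidean_space measure"
  assumes [measurable_cong]: "sets M = sets borel" and fin: "sigma_finite_measure M"
    and inv: "\<And>a. distr M borel (\<lambda>x. a + x) = M"
    and A[measurable]: "A \<in> sets borel" and B[measurable]: "B \<in> sets borel"
  shows "emeasure M A * emeasure lborel B = emeasure lborel A * emeasure M B"
proof -
  interpret M: sigma_finite_measure M by fact
  interpret pair_sigma_finite M "lborel :: 'a measure" ..
  let ?i = "indicator :: 'a set \<Rightarrow> 'a \<Rightarrow> ennreal"
  have shift_M: "(\<integral>\<^sup>+x. f x \<partial>M) = (\<integral>\<^sup>+x. f (a + x) \<partial>M)"
    if [measurable]: "f \<in> borel_measurable borel" for a and f :: "'a \<Rightarrow> ennreal"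
    by (subst inv[of a, symmetric], subst nn_integral_distr) auto
  have shift: "(\<integral>\<^sup>+y. f y \<partial>lborel) = (\<integral>\<^sup>+y. f (a + y) \<partial>lborel)"
    if [measurable]: "f \<in> borel_measurable borel" for a and f :: "'a \<Rightarrow> ennreal"
    by (subst lborel_distr_plus[of a, symmetric], subst nn_integral_distr) auto
  have reflect: "(\<integral>\<^sup>+y. f y \<partial>lborel) = (\<integral>\<^sup>+y. f (a - y) \<partial>lborel)"
    if [measurable]: "f \<in> borel_measurable borel" for a and f :: "'a \<Rightarrow> ennreal"
    by (subst lborel_affine[of "-1" a]) (auto simp: density_1 nn_integral_distr)
  have "emeasure M A * emeasure lborel B = (\<integral>\<^sup>+x. \<integral>\<^sup>+y. ?i A x * ?i B y \<partial>lborel \<partial>M)"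
    by (simp add: nn_integral_cmult nn_integral_multc)
  also have "\<dots> = (\<integral>\<^sup>+x. \<integral>\<^sup>+y. ?i A x * ?i B (x + y) \<partial>lborel \<partial>M)"
    by (intro nn_integral_cong shift) measurable
  also have "\<dots> = (\<integral>\<^sup>+y. \<integral>\<^sup>+x. ?i A x * ?i B (x + y) \<partial>M \<partial>lborel)"
    by (rule Fubini'[symmetric]) measurable
  also have "\<dots> = (\<integral>\<^sup>+y. \<integral>\<^sup>+x. ?i A (- y + x) * ?i B (- y + x + y) \<partial>M \<partial>lborel)"
    by (intro nn_integral_cong shift_M) measurable
  also have "\<dots> = (\<integral>\<^sup>+y. \<integral>\<^sup>+x. ?i A (x - y) * ?i B x \<partial>M \<partial>lborel)" by simp
  also have "\<dots> = (\<integral>\<^sup>+x. \<integral>\<^sup>+y. ?i A (x - y) * ?i B x \<partial>lborel \<partial>M)"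
    by (rule Fubini') measurable
  also have "\<dots> = (\<integral>\<^sup>+x. \<integral>\<^sup>+y. ?i A y * ?i B x \<partial>lborel \<partial>M)"
    by (intro nn_integral_cong reflect[symmetric]) measurable
  also have "\<dots> = emeasure lborel A * emeasure M B"
    by (simp add: nn_integral_cmult nn_integral_multc)
  finally show ?thesis .
qed

text \<open>
  The image of Lebesgue measure under \<open>f\<close> is translation invariant, hence a multiple of Lebesgue
  measure; the factor is \<open>1\<close> because \<open>f\<close> preserves the unit ball.
\<close>
lemma emeasure_orthogonal_vimage:
  fixes f :: "'a::euclidean_space \<Rightarrow> 'a"
  assumes f: "orthogonal_transformation f" and A: "A \<in> sets borel"
  shows "emeasure lborel (f -` A) = emeasure lborel A"
proof -
  have lin: "linear f" using f by (simp add: orthogonal_transformation_linear)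
  have [measurable]: "f \<in> borel_measurable borel"
    using lin by (intro borel_measurable_continuous_onI linear_continuous_on)
      (simp add: linear_conv_bounded_linear)
  define M where "M = distr lborel borel f"
  have sets: "sets M = sets borel" by (simp add: M_def)
  have ball: "f -` ball 0 r = ball 0 r" for r
    using f by (auto simp: orthogonal_transformation dist_norm)
  have M: "emeasure M S = emeasure lborel (f -` S)" if "S \<in> sets borel" for S
    unfolding M_def using that by (subst emeasure_distr) auto
  have "sigma_finite_measure M"
  proof
    show "\<exists>S. countable S \<and> S \<subseteq> sets M \<and> \<Union>S = space M \<and> (\<forall>a\<in>S. emeasure M a \<noteq> \<infinity>)"
    proof (intro exI[of _ "range (\<lambda>n::nat. ball 0 (real n))"] conjI)
      show "\<Union> (range (\<lambda>n::nat. ball (0::'a) (real n))) = space M"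
        using reals_Archimedean2 by (auto simp: M_def)
    qed (use emeasure_lborel_ball_finite in \<open>auto simp: sets M ball less_top[symmetric]\<close>)
  qed
  moreover have "distr M borel (\<lambda>x. a + x) = M" for a
  proof -
    obtain b where b: "a = f b" using f by (metis orthogonal_transformation_surj surjD)
    have "distr M borel (\<lambda>x. a + x) = distr lborel borel (\<lambda>x. f (b + x))"
      unfolding M_def b by (subst distr_distr) (auto simp: o_def linear_add[OF lin])
    also have "\<dots> = distr (distr lborel borel (\<lambda>x. b + x)) borel f"
      by (subst distr_distr) (auto simp: o_def)
    also have "\<dots> = M" unfolding M_def by (simp add: lborel_distr_plus)
    finally show ?thesis .
  qed
  ultimately have "emeasure M A * emeasure lborel (ball 0 1 :: 'a set) =
      emeasure lborel A * emeasure M (ball 0 1)"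
    using A by (intro translation_invariant_proportional_lborel sets) auto
  then have "emeasure M A * emeasure lborel (ball 0 1 :: 'a set) =
      emeasure lborel A * emeasure lborel (ball 0 1 :: 'a set)"
    by (simp add: M ball)
  moreover have "emeasure lborel (ball 0 1 :: 'a set) \<noteq> 0" "emeasure lborel (ball 0 1 :: 'a set) \<noteq> top"
    using content_ball_pos[of 1 "0::'a"] emeasure_lborel_ball_finite[of "0::'a" 1]
    by (auto simp: measure_def enn2real_positive_iff)
  ultimately show ?thesis using A by (simp add: M mult.commute[of _ "emeasure lborel (ball 0 1 :: 'a set)"] ennreal_mult_cancel_left)
qed

text \<open>
  For an orthonormal set \<open>B\<close> this is multiplication by \<open>t\<close> on the span of \<open>B\<close> and the identity on
  its orthogonal complement.
\<close>
definition stretch :: "real \<Rightarrow> 'a::real_inner set \<Rightarrow> 'a \<Rightarrow> 'a" where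
  "stretch t B x = x + (t - 1) *\<^sub>R (\<Sum>w\<in>B. (x \<bullet> w) *\<^sub>R w)"

lemma continuous_on_stretch: "continuous_on S (stretch t B)"
  unfolding stretch_def by (intro continuous_intros)

lemma measurable_stretch [measurable]:
  "stretch t B \<in> borel_measurable (borel :: 'a::euclidean_space measure)"
  by (intro borel_measurable_continuous_onI continuous_on_stretch)

text \<open>
  A rotation that carries a coordinate vector to \<open>w\<close> reduces the claim to the rescaling of one
  coordinate.
\<close>
lemma emeasure_stretch_single_vimage:
  fixes A :: "(real ^ 'n) set"
  assumes t: "0 < t" and w: "norm w = 1" and A: "A \<in> sets borel"
  shows "emeasure lborel (stretch t {w} -` A) = ennreal (1 / t) * emeasure lborel A"
proof -
  let ?e = "axis undefined 1 :: real ^ 'n"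
  obtain f where f: "orthogonal_transformation f" "f ?e = w"
    using orthogonal_transformation_exists_1[of ?e w] w by auto
  have lin: "linear f" using f by (simp add: orthogonal_transformation_linear)
  have [measurable]: "f \<in> borel_measurable borel"
    using lin by (intro borel_measurable_continuous_onI linear_continuous_on)
      (simp add: linear_conv_bounded_linear)
  have conj: "stretch t {w} (f x) = f (stretch t {?e} x)" for x
    using f(1) unfolding stretch_def f(2)[symmetric]
    by (simp add: linear_add[OF lin] linear_cmul[OF lin] orthogonal_transformation_def)
  have axis: "stretch t {?e} x = 0 + (\<Sum>j\<in>Basis. ((if j = ?e then t else 1) * (x \<bullet> j)) *\<^sub>R j)" for x
  proof -
    have "(\<Sum>j\<in>Basis. ((if j = ?e then t else 1) * (x \<bullet> j)) *\<^sub>R j) =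
        (\<Sum>j\<in>Basis. (x \<bullet> j) *\<^sub>R j + (if j = ?e then ((t - 1) * (x \<bullet> j)) *\<^sub>R j else 0))"
      by (intro sum.cong) (auto simp: algebra_simps)
    then show ?thesis by (simp add: sum.distrib euclidean_representation stretch_def)
  qed
  have axis': "stretch t {?e} = (\<lambda>x. 0 + (\<Sum>j\<in>Basis. ((if j = ?e then t else 1) * (x \<bullet> j)) *\<^sub>R j))"
    by (rule ext, rule axis)
  have axis_vol: "emeasure lborel S = ennreal t * emeasure lborel (stretch t {?e} -` S)"
    if S[measurable]: "S \<in> sets borel" for S
  proof -
    have "lborel = density (distr lborel borel (stretch t {?e})) (\<lambda>_. (\<Prod>j\<in>(Basis::(real^'n) set). \<bar>if j = ?e then t else 1\<bar>))"
      unfolding axis' by (rule lborel_affine_euclidean) (use t in auto)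
    also have "(\<Prod>j\<in>(Basis::(real^'n) set). \<bar>if j = ?e then t else 1\<bar>) = t"
    proof -
      have "(\<Prod>j\<in>(Basis::(real^'n) set). \<bar>if j = ?e then t else 1\<bar>) = (\<Prod>j\<in>(Basis::(real^'n) set). if j = ?e then t else 1)"
        using t by (intro prod.cong) auto
      then show ?thesis by (simp add: axis_in_Basis_iff)
    qed
    finally have "emeasure lborel S = emeasure (density (distr lborel borel (stretch t {?e})) (\<lambda>_. ennreal t)) S"
      by metis
    also have "\<dots> = ennreal t * emeasure (distr lborel borel (stretch t {?e})) S"
      by (subst emeasure_density) (auto simp: nn_integral_cmult_indicator)
    also have "\<dots> = ennreal t * emeasure lborel (stretch t {?e} -` S)"
      by (subst emeasure_distr) auto
    finally show ?thesis .
  qed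
  have sA: "stretch t {w} -` A \<in> sets borel" "f -` A \<in> sets borel"
    using measurable_sets[of "stretch t {w}" borel borel A] measurable_sets[of f borel borel A] A by auto
  have "emeasure lborel (stretch t {w} -` A) = emeasure lborel (f -` (stretch t {w} -` A))"
    by (rule emeasure_orthogonal_vimage[OF f(1) sA(1), symmetric])
  also have "f -` (stretch t {w} -` A) = stretch t {?e} -` (f -` A)" by (auto simp: conj)
  also have "emeasure lborel \<dots> = ennreal (1 / t) * (ennreal t * emeasure lborel (stretch t {?e} -` (f -` A)))"
  proof -
    have "ennreal (1 / t) * ennreal t = 1" using t by (simp add: ennreal_mult[symmetric])
    then show ?thesis by (simp add: mult.assoc[symmetric])
  qed
  also have "\<dots> = ennreal (1 / t) * emeasure lborel (f -` A)" by (simp only: axis_vol[OF sA(2)])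
  also have "\<dots> = ennreal (1 / t) * emeasure lborel A" by (simp add: emeasure_orthogonal_vimage[OF f(1) A])
  finally show ?thesis .
qed

text \<open>
  Stretchings in orthogonal directions compose, so that each element of \<open>B\<close> contributes one factor.
\<close>
lemma emeasure_stretch_vimage:
  fixes A :: "(real ^ 'n) set"
  assumes t: "0 < t" and B: "finite B" "pairwise orthogonal B" "\<And>w. w \<in> B \<Longrightarrow> norm w = 1"
    and A: "A \<in> sets borel"
  shows "emeasure lborel (stretch t B -` A) = ennreal ((1 / t) ^ card B) * emeasure lborel A"
  using B A
proof (induction B arbitrary: A rule: finite_induct)
  case empty
  then show ?case by (simp add: stretch_def vimage_def)
next
  case (insert w B)
  have comp: "stretch t (insert w B) x = stretch t {w} (stretch t B x)" for x
  proof -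
    have "(\<Sum>v\<in>B. (x \<bullet> v) *\<^sub>R v) \<bullet> w = (\<Sum>v\<in>B. (x \<bullet> v) * (v \<bullet> w))"
      by (simp add: inner_sum_left)
    also have "\<dots> = 0"
      using insert by (intro sum.neutral) (auto simp: pairwise_def orthogonal_def inner_commute)
    finally show ?thesis
      using insert by (simp add: stretch_def inner_add_left algebra_simps)
  qed
  have sA: "stretch t {w} -` A \<in> sets borel"
    using measurable_sets[of "stretch t {w}" borel borel A] insert.prems by auto
  have "stretch t (insert w B) -` A = stretch t B -` (stretch t {w} -` A)" by (auto simp: comp)
  then have "emeasure lborel (stretch t (insert w B) -` A) =
      ennreal ((1 / t) ^ card B) * emeasure lborel (stretch t {w} -` A)"
    using insert.IH[of "stretch t {w} -` A"] insert.prems sA by (simp add: pairwise_insert)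
  also have "\<dots> = ennreal ((1 / t) ^ card B) * (ennreal (1 / t) * emeasure lborel A)"
    using emeasure_stretch_single_vimage[OF t, of w A] insert.prems by simp
  also have "\<dots> = ennreal ((1 / t) ^ card B * (1 / t)) * emeasure lborel A"
    using t by (subst ennreal_mult) (auto simp: mult.assoc)
  finally show ?case using insert.hyps by (simp add: mult.commute)
qed

section \<open>The projection onto a closed convex set and its rays\<close>

locale nonempty_closed_convex =
  fixes K :: "(real ^ 'n) set"
  assumes nonempty: "K \<noteq> {}" and closed: "closed K" and convex: "convex K"
begin

abbreviation proj :: "real ^ 'n \<Rightarrow> real ^ 'n" where "proj \<equiv> closest_point K"

text \<open>
  The point on the normal ray through \<open>x\<close> whose distance to \<open>K\<close> is \<open>t\<close> times that of \<open>x\<close>. For \<open>t > 0\<close> these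
  maps form a multiplicative group of bijections of the complement of \<open>K\<close>.
\<close>
definition ray :: "real \<Rightarrow> real ^ 'n \<Rightarrow> real ^ 'n" where
  "ray t x = proj x + t *\<^sub>R (x - proj x)"

lemma proj_in: "proj x \<in> K"
  using closest_point_in_set closed nonempty by blast

lemma proj_obtuse: "y \<in> K \<Longrightarrow> (x - proj x) \<bullet> (y - proj x) \<le> 0"
  using closest_point_dot convex closed by blast

text \<open>
  Firm nonexpansiveness, the sum of the two obtuse angle conditions.
\<close>
lemma proj_firm: "(norm (proj x - proj y))\<^sup>2 \<le> (proj x - proj y) \<bullet> (x - y)"
  using proj_obtuse[OF proj_in, of x y] proj_obtuse[OF proj_in, of y x]
  by (simp add: power2_norm_eq_inner inner_diff_left inner_diff_right inner_commute)

lemma proj_nonexpansive: "norm (proj x - proj y) \<le> norm (x - y)"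
  using closest_point_lipschitz[OF convex closed nonempty, of x y] by (simp add: dist_norm)

lemma continuous_on_proj: "continuous_on S proj"
  using continuous_on_closest_point convex closed nonempty by blast

lemma infdist_eq_norm: "infdist x K = norm (x - proj x)"
  using setdist_closest_point[OF closed nonempty, of x] by (simp add: infdist_eq_setdist dist_norm)

lemma outside_iff: "x \<notin> K \<longleftrightarrow> 0 < infdist x K"
  using closest_point_refl[OF closed nonempty, of x] by (auto simp: infdist_eq_norm)

lemma proj_eqI:
  assumes "y \<in> K" and obtuse: "\<And>z. z \<in> K \<Longrightarrow> (x - y) \<bullet> (z - y) \<le> 0"
  shows "proj x = y"
proof (rule closest_point_unique[OF convex closed assms(1), symmetric], rule ballI)
  fix z assume "z \<in> K"
  have "(norm (x - z))\<^sup>2 = (norm (x - y))\<^sup>2 + (norm (z - y))\<^sup>2 - 2 * ((x - y) \<bullet> (z - y))"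
    by (simp add: power2_norm_eq_inner inner_diff_left inner_diff_right inner_commute)
  with obtuse[OF \<open>z \<in> K\<close>] have "(norm (x - y))\<^sup>2 \<le> (norm (x - z))\<^sup>2"
    using zero_le_power2[of "norm (z - y)"] by linarith
  then show "dist x y \<le> dist x z" by (simp add: dist_norm)
qed

lemma proj_ray: "0 \<le> t \<Longrightarrow> proj (ray t x) = proj x"
  using proj_obtuse by (intro proj_eqI proj_in) (simp add: ray_def mult_nonneg_nonpos)

lemma ray_ray: "0 \<le> t \<Longrightarrow> ray s (ray t x) = ray (s * t) x"
  by (subst ray_def) (simp add: proj_ray, simp add: ray_def)

lemma ray_one [simp]: "ray 1 x = x"
  by (simp add: ray_def)

lemma infdist_ray: "0 \<le> t \<Longrightarrow> infdist (ray t x) K = t * infdist x K"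
  unfolding infdist_eq_norm by (simp add: proj_ray) (simp add: ray_def)

lemma ray_outside: "0 < t \<Longrightarrow> ray t x \<in> K \<longleftrightarrow> x \<in> K"
  using outside_iff[of x] outside_iff[of "ray t x"] by (auto simp: infdist_ray zero_less_mult_iff)

text \<open>
  Contraction towards \<open>K\<close> is a convex combination of the identity and of the projection.
\<close>
lemma ray_nonexpansive:
  assumes "0 \<le> t" "t \<le> 1"
  shows "norm (ray t x - ray t y) \<le> norm (x - y)"
proof -
  have "ray t x - ray t y = t *\<^sub>R (x - y) + (1 - t) *\<^sub>R (proj x - proj y)"
    by (simp add: ray_def algebra_simps)
  also have "norm \<dots> \<le> t * norm (x - y) + (1 - t) * norm (proj x - proj y)"
    using norm_triangle_ineq[of "t *\<^sub>R (x - y)" "(1 - t) *\<^sub>R (proj x - proj y)"] assms by simp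
  also have "\<dots> \<le> t * norm (x - y) + (1 - t) * norm (x - y)"
    using assms proj_nonexpansive by (intro add_left_mono mult_left_mono) auto
  finally show ?thesis by (simp add: algebra_simps)
qed

lemma continuous_on_ray: "continuous_on S (ray t)"
  unfolding ray_def by (intro continuous_intros continuous_on_proj)

lemma measurable_ray [measurable]: "ray t \<in> borel_measurable borel"
  by (intro borel_measurable_continuous_onI continuous_on_ray)

lemma ray_image_eq:
  assumes "0 < t" "A \<inter> K = {}"
  shows "ray (1 / t) ` A = - K \<inter> ray t -` A"
proof (intro equalityI subsetI)
  fix x assume "x \<in> ray (1 / t) ` A"
  then obtain a where "a \<in> A" "x = ray (1 / t) a" by blast
  then show "x \<in> - K \<inter> ray t -` A"
    using assms by (auto simp: ray_ray ray_outside)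
next
  fix x assume "x \<in> - K \<inter> ray t -` A"
  then show "x \<in> ray (1 / t) ` A"
    using assms by (intro image_eqI[of _ _ "ray t x"]) (auto simp: ray_ray)
qed

text \<open>
  The squared distance differs from its linearisation at \<open>x\<close> by at most \<open>(norm (z - x))\<^sup>2\<close>. For the
  upper bound compare \<open>z\<close> with the nearest point of \<open>x\<close>, for the lower bound \<open>x\<close> with the nearest
  point of \<open>z\<close> and use that the projection is nonexpansive.
\<close>
lemma infdist_has_derivative:
  assumes x: "x \<notin> K"
  shows "((\<lambda>z. infdist z K) has_derivative (\<lambda>h. sgn (x - proj x) \<bullet> h)) (at x)"
proof -
  have bound: "\<bar>(infdist z K)\<^sup>2 - (infdist x K)\<^sup>2 - 2 * ((x - proj x) \<bullet> (z - x))\<bar> \<le> (norm (z - x))\<^sup>2" for z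
  proof -
    have "norm (z - proj z) \<le> norm (z - proj x)" "norm (x - proj x) \<le> norm (x - proj z)"
      using closest_point_le[OF closed proj_in] by (simp_all add: dist_norm)
    then have "(norm (z - proj z))\<^sup>2 \<le> (norm (z - proj x))\<^sup>2" "(norm (x - proj x))\<^sup>2 \<le> (norm (x - proj z))\<^sup>2"
      by (simp_all add: power_mono)
    moreover have "(norm (z - proj x))\<^sup>2 =
        (norm (x - proj x))\<^sup>2 + 2 * ((x - proj x) \<bullet> (z - x)) + (norm (z - x))\<^sup>2"
      by (simp add: power2_norm_eq_inner inner_diff_left inner_diff_right inner_commute)
    moreover have "(norm (x - proj z))\<^sup>2 = (norm (z - proj z))\<^sup>2 -
        2 * ((x - proj x) \<bullet> (z - x)) - (norm (z - x))\<^sup>2 + 2 * ((proj z - proj x) \<bullet> (z - x))"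
      by (simp add: power2_norm_eq_inner inner_diff_left inner_diff_right inner_commute)
    moreover have "(proj z - proj x) \<bullet> (z - x) \<le> norm (z - x) * norm (z - x)"
      by (rule order.trans[OF norm_cauchy_schwarz mult_right_mono]) (auto simp: proj_nonexpansive)
    ultimately show ?thesis
      by (simp add: infdist_eq_norm power2_eq_square[of "norm (z - x)"] abs_le_iff)
  qed
  have "((\<lambda>z. (infdist z K)\<^sup>2) has_derivative (\<lambda>h. 2 * ((x - proj x) \<bullet> h))) (at x)"
    unfolding has_derivative_at_alt
  proof (intro conjI allI impI)
    show "bounded_linear (\<lambda>h. 2 * ((x - proj x) \<bullet> h))"
      by (intro bounded_linear_intros)
    fix e :: real assume "0 < e"
    have "norm ((infdist z K)\<^sup>2 - (infdist x K)\<^sup>2 - 2 * ((x - proj x) \<bullet> (z - x))) \<le> e * norm (z - x)"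
      if "norm (z - x) < e" for z
    proof -
      have "(norm (z - x))\<^sup>2 \<le> e * norm (z - x)"
        unfolding power2_eq_square using that by (intro mult_right_mono) auto
      with bound[of z] show ?thesis by simp
    qed
    with \<open>0 < e\<close> show "\<exists>d>0. \<forall>z. norm (z - x) < d \<longrightarrow>
        norm ((infdist z K)\<^sup>2 - (infdist x K)\<^sup>2 - 2 * ((x - proj x) \<bullet> (z - x))) \<le> e * norm (z - x)"
      by blast
  qed
  moreover have pos: "0 < (infdist x K)\<^sup>2" using x outside_iff by simp
  ultimately have "((\<lambda>z. sqrt ((infdist z K)\<^sup>2)) has_derivative
      (\<lambda>h. 2 * ((x - proj x) \<bullet> h) * (inverse (sqrt ((infdist x K)\<^sup>2)) / 2))) (at x)"
    by (intro has_derivative_real_sqrt)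
  moreover have "2 * ((x - proj x) \<bullet> h) * (inverse (sqrt ((infdist x K)\<^sup>2)) / 2) =
      sgn (x - proj x) \<bullet> h" for h
    unfolding infdist_eq_norm by (simp add: sgn_div_norm)
  moreover have "sqrt ((infdist z K)\<^sup>2) = infdist z K" for z by (simp add: infdist_nonneg)
  ultimately show ?thesis by simp
qed

lemma grad_boundary_dist:
  assumes "x \<notin> K"
  shows "grad (boundary_dist (UNIV - K)) x = sgn (x - proj x)"
proof -
  have "boundary_dist (UNIV - K) = (\<lambda>z. infdist z K)"
    by (auto simp: boundary_dist_def double_diff)
  then have "frechet_derivative (boundary_dist (UNIV - K)) (at x) = (\<lambda>h. sgn (x - proj x) \<bullet> h)"
    using frechet_derivative_at[OF infdist_has_derivative[OF assms]] by simp
  then show ?thesis by (simp add: grad_def vec_eq_iff inner_axis)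
qed

section \<open>Contraction of volume towards a convex set\<close>

text \<open>
  Orthonormal directions in which the projection does not move to first order at \<open>y\<close>: where the
  projection is differentiable, its derivative followed by the orthogonal projection onto the span
  of \<open>B\<close> vanishes. Phrased as an estimate of increments, the condition also makes
  sense at the other points. The radius bound is nonstrict so as to fit closed balls.
\<close>
definition normal_directions :: "real ^ 'n \<Rightarrow> (real ^ 'n) set \<Rightarrow> bool" where
  "normal_directions y B \<longleftrightarrow> finite B \<and> pairwise orthogonal B \<and> (\<forall>w\<in>B. norm w = 1) \<and>
     (\<forall>\<eta>>0. \<exists>r>0. \<forall>z. dist z y \<le> r \<longrightarrow>
        norm (\<Sum>w\<in>B. ((proj z - proj y) \<bullet> w) *\<^sub>R w) \<le> \<eta> * dist z y)"

text \<open>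
  With \<open>n\<close> the outer unit normal \<open>sgn (x - proj x)\<close>, the obtuse angle conditions give
  \<open>(proj z - proj y) \<bullet> n y \<le> 0 \<le> (proj z - proj y) \<bullet> n z\<close>; hence the first product is at most
  \<open>norm (proj z - proj y) * norm (n z - n y)\<close> in absolute value, and \<open>n\<close> is continuous.
\<close>
lemma normal_directions_gradient:
  assumes y: "y \<notin> K"
  shows "normal_directions y {sgn (y - proj y)}"
proof -
  let ?n = "\<lambda>x. sgn (x - proj x)"
  have ne: "y - proj y \<noteq> 0" 
  proof
    assume "y - proj y = 0"
    then have "proj y = y" by simp
    with proj_in[of y] y show False by simp
  qed
  have n1: "norm (?n y) = 1" using ne by (simp add: norm_sgn)
  have "isCont ?n y"
    using ne continuous_on_proj[of UNIV]
    by (intro isCont_sgn continuous_intros) (simp_all add: continuous_on_eq_continuous_at)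
  then have small: "\<exists>r>0. \<forall>z. dist z y \<le> r \<longrightarrow> norm (((proj z - proj y) \<bullet> ?n y) *\<^sub>R ?n y) \<le> \<eta> * dist z y"
    if "0 < \<eta>" for \<eta>
  proof -
    obtain r where r: "0 < r" "\<And>z. dist z y < r \<Longrightarrow> dist (?n z) (?n y) < \<eta>"
      using \<open>isCont ?n y\<close> \<open>0 < \<eta>\<close> unfolding continuous_at_eps_delta by blast
    have "norm (((proj z - proj y) \<bullet> ?n y) *\<^sub>R ?n y) \<le> \<eta> * dist z y" if z: "dist z y \<le> r / 2" for z
    proof -
      let ?q = "proj z - proj y"
      have "?q \<bullet> ?n y \<le> 0"
        using proj_obtuse[OF proj_in, of y z]
        by (simp add: sgn_div_norm inner_commute mult_nonneg_nonpos divide_nonpos_nonneg)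
      moreover have "0 \<le> ?q \<bullet> ?n z"
        using proj_obtuse[OF proj_in, of z y]
        by (simp add: sgn_div_norm inner_commute inner_diff_left inner_diff_right divide_nonneg_nonneg)
      ultimately have "\<bar>?q \<bullet> ?n y\<bar> \<le> ?q \<bullet> (?n z - ?n y)" by (simp add: inner_diff_right)
      also have "\<dots> \<le> norm ?q * norm (?n z - ?n y)" by (rule norm_cauchy_schwarz)
      also have "\<dots> \<le> norm (z - y) * \<eta>"
        using proj_nonexpansive[of z y] r(2)[of z] z \<open>0 < r\<close>
        by (intro mult_mono) (auto simp: dist_norm)
      finally show ?thesis using n1 by (simp add: dist_norm mult.commute)
    qed
    then show ?thesis using r(1) by (intro exI[of _ "r / 2"]) auto
  qed
  show ?thesis unfolding normal_directions_def using n1 small by (simp add: pairwise_def)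
qed

text \<open>
  The projection takes its values in \<open>K\<close>, hence does not move at all in the directions orthogonal to
  the affine hull of \<open>K\<close>.
\<close>
lemma normal_directions_flat:
  obtains B where "card B = nat (int CARD('n) - aff_dim K)" "\<And>y. normal_directions y B"
proof -
  obtain a where a: "a \<in> K" using nonempty by blast
  define L where "L = span ((\<lambda>x. x - a) ` K)"
  define W where "W = {w \<in> UNIV. \<forall>v\<in>L. orthogonal v w}"
  have "subspace W" by (auto simp: W_def subspace_def orthogonal_clauses)
  then obtain B where B: "B \<subseteq> W" "pairwise orthogonal B" "\<And>w. w \<in> B \<Longrightarrow> norm w = 1"
    "independent B" "card B = dim W"
    using orthonormal_basis_subspace[of W] by metis
  have "dim W + dim L = CARD('n)"
    using dim_subspace_orthogonal_to_vectors[of L UNIV] unfolding W_def by (simp add: L_def)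
  moreover have "aff_dim K = int (dim L)"
    using aff_dim_eq_dim_subtract[of a K] a by (simp add: L_def hull_inc)
  ultimately have "card B = nat (int CARD('n) - aff_dim K)" using B(5) by simp
  moreover have "(proj z - proj y) \<bullet> w = 0" if "w \<in> B" for w z y
  proof -
    have "proj z - a \<in> L" "proj y - a \<in> L"
      using proj_in by (auto simp: L_def intro: span_base)
    then have "(proj z - a) - (proj y - a) \<in> L" unfolding L_def by (rule span_diff)
    then show ?thesis using that B(1) by (auto simp: W_def orthogonal_def)
  qed
  then have "normal_directions y B" for y
    unfolding normal_directions_def using B independent_imp_finite[OF B(4)] by (auto intro: exI[of _ 1])
  ultimately show ?thesis using that by blast
qed

text \<open>
  Undoing the contraction in the normal directions: stretching the image by \<open>t\<close> along \<open>B\<close> leaves a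
  map that is \<open>(1 + \<epsilon>)\<close>-Lipschitz at \<open>y\<close>. If the increment of the projection had no component
  along \<open>B\<close> at all, firm nonexpansiveness would bound its norm by that of the tangential part of the
  increment \<open>h\<close>, and the claim would hold with \<open>\<epsilon> = 0\<close>. The proof carries along the error that a
  normal component of size at most \<open>\<kappa>\<^sup>2 * norm h\<close> causes.
\<close>
lemma stretched_contraction_bound:
  assumes nd: "normal_directions y B" and t: "1 \<le> t" and \<epsilon>: "0 < \<epsilon>"
  obtains r where "0 < r"
    "\<And>z. dist z y \<le> r \<Longrightarrow> norm (stretch t B (ray (1 / t) z - ray (1 / t) y)) \<le> (1 + \<epsilon>) * dist z y"
proof -
  \<comment> \<open>Chosen so that the accumulated error \<open>\<kappa> + (t - 1) * \<kappa>\<close> is at most \<open>\<epsilon>\<close>.\<close>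
  define \<kappa> where "\<kappa> = min 1 (\<epsilon> / t)"
  have \<kappa>: "0 < \<kappa>" "\<kappa> \<le> 1" "t * \<kappa> \<le> \<epsilon>" using t \<epsilon> by (auto simp: \<kappa>_def min_def field_simps)
  define pr where "pr x = (\<Sum>w\<in>B. (x \<bullet> w) *\<^sub>R w)" for x :: "real ^ 'n"
  have B: "finite B" "pairwise orthogonal B" "\<And>w. w \<in> B \<Longrightarrow> norm w = 1"
    using nd by (auto simp: normal_directions_def)
  have pr_linear: "pr (a *\<^sub>R x + b *\<^sub>R x') = a *\<^sub>R pr x + b *\<^sub>R pr x'" for a b x x'
    by (simp add: pr_def inner_add_left scaleR_add_left sum.distrib scaleR_sum_right)
  have pr_dot: "pr x \<bullet> w = x \<bullet> w" if w: "w \<in> B" for x w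
  proof -
    have "pr x \<bullet> w = (\<Sum>v\<in>B. (x \<bullet> v) * (v \<bullet> w))" by (simp add: pr_def inner_sum_left)
    also have "\<dots> = (\<Sum>v\<in>B. if v = w then x \<bullet> w else 0)"
      using B w by (intro sum.cong) (auto simp: pairwise_def orthogonal_def norm_eq_1)
    finally show ?thesis using B(1) w by simp
  qed
  have perp: "(x - pr x) \<bullet> pr x' = 0" for x x'
    unfolding pr_def[of x'] by (simp add: inner_sum_right inner_diff_left pr_dot)
  have pyth: "(norm x)\<^sup>2 = (norm (pr x))\<^sup>2 + (norm (x - pr x))\<^sup>2" for x
    using perp[of x x]
    by (simp add: power2_norm_eq_inner inner_diff_left inner_diff_right inner_commute)
  obtain r where r: "0 < r" "\<And>z. dist z y \<le> r \<Longrightarrow> norm (pr (proj z - proj y)) \<le> \<kappa>\<^sup>2 * dist z y"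
    using nd zero_less_power[OF \<kappa>(1), of 2] unfolding normal_directions_def pr_def by blast
  have "norm (stretch t B (ray (1 / t) z - ray (1 / t) y)) \<le> (1 + \<epsilon>) * dist z y" if z: "dist z y \<le> r" for z
  proof -
    \<comment> \<open>Primes denote the parts orthogonal to \<open>B\<close>.\<close>
    define h where "h = z - y"
    define q where "q = proj z - proj y"
    define h' where "h' = h - pr h"
    define q' where "q' = q - pr q"
    have d: "dist z y = norm h" by (simp add: h_def dist_norm)
    have small: "norm (pr q) \<le> \<kappa>\<^sup>2 * norm h" using r(2)[OF z] by (simp add: q_def d)
    have u: "ray (1 / t) z - ray (1 / t) y = (1 / t) *\<^sub>R h + (1 - 1 / t) *\<^sub>R q"
      by (simp add: ray_def h_def q_def algebra_simps)
    define v where "v = (1 / t) *\<^sub>R h' + (1 - 1 / t) *\<^sub>R q'"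
    have "stretch t B (ray (1 / t) z - ray (1 / t) y) =
        ((1 / t) *\<^sub>R h + (1 - 1 / t) *\<^sub>R q) + (t - 1) *\<^sub>R ((1 / t) *\<^sub>R pr h + (1 - 1 / t) *\<^sub>R pr q)"
      unfolding stretch_def u pr_def[symmetric] pr_linear ..
    also have "\<dots> = pr h + v + (t - 1) *\<^sub>R pr q"
    proof -
      have "(t - 1) * (1 / t) = 1 - 1 / t" "(t - 1) * (1 - 1 / t) = (t - 1) - (1 - 1 / t)"
        using t by (auto simp: field_simps)
      then show ?thesis
        by (simp add: v_def h'_def q'_def scaleR_add_right scaleR_diff_right scaleR_diff_left
            del: times_divide_eq_right)
    qed
    finally have eq: "stretch t B (ray (1 / t) z - ray (1 / t) y) = pr h + v + (t - 1) *\<^sub>R pr q" .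
    have q'_le: "norm q' \<le> norm h' + \<kappa> * norm h"
    proof -
      have "(norm q')\<^sup>2 \<le> (norm q)\<^sup>2" using pyth[of q] by (simp add: q'_def)
      also have "\<dots> \<le> q \<bullet> h" using proj_firm[of z y] by (simp add: q_def h_def)
      also have "\<dots> = pr q \<bullet> h + q' \<bullet> h'"
        using perp[of q h] by (simp add: q'_def h'_def inner_diff_left inner_diff_right)
      also have "\<dots> \<le> norm (pr q) * norm h + norm q' * norm h'"
        by (intro add_mono norm_cauchy_schwarz)
      also have "norm (pr q) * norm h \<le> \<kappa>\<^sup>2 * norm h * norm h"
        by (intro mult_right_mono small) simp
      finally have *: "(norm q')\<^sup>2 \<le> (\<kappa> * norm h)\<^sup>2 + norm q' * norm h'"
        by (simp add: power2_eq_square algebra_simps)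
      show ?thesis
      proof (rule ccontr)
        assume "\<not> ?thesis"
        then have gt: "\<kappa> * norm h < norm q' - norm h'" by simp
        have nn: "0 \<le> \<kappa> * norm h" using \<kappa> by simp
        have "(\<kappa> * norm h)\<^sup>2 < (norm q' - norm h') * norm q'"
          unfolding power2_eq_square using gt nn norm_ge_zero[of h']
          by (intro mult_strict_mono') linarith+
        with * show False by (simp add: power2_eq_square algebra_simps)
      qed
    qed
    have v_le: "norm v \<le> norm h' + \<kappa> * norm h"
    proof -
      have "norm v \<le> (1 / t) * norm h' + (1 - 1 / t) * norm q'"
        unfolding v_def using norm_triangle_ineq[of "(1 / t) *\<^sub>R h'" "(1 - 1 / t) *\<^sub>R q'"] t by simp
      also have "\<dots> \<le> (1 / t) * (norm h' + \<kappa> * norm h) + (1 - 1 / t) * (norm h' + \<kappa> * norm h)"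
        using t \<kappa>(1) q'_le by (intro add_mono mult_left_mono) auto
      finally show ?thesis by (simp add: algebra_simps)
    qed
    have "(norm (pr h + v))\<^sup>2 = (norm (pr h))\<^sup>2 + (norm v)\<^sup>2"
      using perp[of h h] perp[of q h]
      by (simp add: power2_norm_eq_inner inner_add_left inner_add_right v_def h'_def q'_def inner_commute)
    also have "\<dots> \<le> (norm (pr h))\<^sup>2 + (norm h' + \<kappa> * norm h)\<^sup>2"
      using v_le by (intro add_left_mono power_mono) auto
    also have "\<dots> = (norm h)\<^sup>2 + 2 * \<kappa> * (norm h' * norm h) + (\<kappa> * norm h)\<^sup>2"
      using pyth[of h] by (simp add: h'_def power2_sum)
    also have "\<dots> \<le> (norm h)\<^sup>2 + 2 * \<kappa> * (norm h * norm h) + (\<kappa> * norm h)\<^sup>2"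
    proof -
      have "(norm h')\<^sup>2 \<le> (norm h)\<^sup>2" using pyth[of h] by (simp add: h'_def)
      then have "norm h' \<le> norm h" by simp
      then show ?thesis using \<kappa> by (intro add_mono mult_left_mono mult_right_mono) auto
    qed
    also have "\<dots> = ((1 + \<kappa>) * norm h)\<^sup>2" by (simp add: power2_eq_square algebra_simps)
    finally have "norm (pr h + v) \<le> (1 + \<kappa>) * norm h" by (rule power2_le_imp_le) (use \<kappa> in simp)
    moreover have "norm ((t - 1) *\<^sub>R pr q) \<le> (t - 1) * (\<kappa> * norm h)"
    proof -
      have "\<kappa>\<^sup>2 * norm h \<le> \<kappa> * norm h"
        using \<kappa> by (intro mult_right_mono) (auto simp: power2_eq_square mult_le_cancel_left1)
      with small t show ?thesis by (simp add: mult_left_mono)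
    qed
    ultimately have "norm (stretch t B (ray (1 / t) z - ray (1 / t) y)) \<le>
        (1 + \<kappa>) * norm h + (t - 1) * (\<kappa> * norm h)"
      unfolding eq using norm_triangle_ineq[of "pr h + v" "(t - 1) *\<^sub>R pr q"] by linarith
    also have "\<dots> = (1 + t * \<kappa>) * norm h" by (simp add: algebra_simps)
    also have "\<dots> \<le> (1 + \<epsilon>) * norm h" using \<kappa> by (intro mult_right_mono) auto
    finally show ?thesis by (simp add: d)
  qed
  with r(1) show ?thesis using that by blast
qed

text \<open>
  The image of a small ball around \<open>y\<close> lies in a translate of the ellipsoid with semi-axes
  \<open>(1 + \<epsilon>) * r / t\<close> along \<open>B\<close> and \<open>(1 + \<epsilon>) * r\<close> orthogonally to \<open>B\<close>.
\<close>
lemma emeasure_ray_image_cball_le: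
  assumes nd: "normal_directions y B" and t: "1 \<le> t" and \<epsilon>: "0 < \<epsilon>"
  obtains r0 where "0 < r0"
    "\<And>r. 0 < r \<Longrightarrow> r \<le> r0 \<Longrightarrow> emeasure lborel (ray (1 / t) ` cball y r) \<le>
       ennreal ((1 / t) ^ card B * (1 + \<epsilon>) ^ CARD('n)) * emeasure lborel (cball y r)"
proof -
  from stretched_contraction_bound[OF nd t \<epsilon>] obtain r0 where r0: "0 < r0"
    "\<And>z. dist z y \<le> r0 \<Longrightarrow> norm (stretch t B (ray (1 / t) z - ray (1 / t) y)) \<le> (1 + \<epsilon>) * dist z y"
    by blast
  have B: "finite B" "pairwise orthogonal B" "\<And>w. w \<in> B \<Longrightarrow> norm w = 1"
    using nd by (auto simp: normal_directions_def)
  show ?thesis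
  proof (rule that[OF r0(1)])
    fix r assume r: "0 < r" "r \<le> r0"
    define E where "E = stretch t B -` cball 0 ((1 + \<epsilon>) * r)"
    have E: "E \<in> sets borel"
      unfolding E_def using measurable_sets[of "stretch t B" borel borel] by auto
    have "ray (1 / t) ` cball y r \<subseteq> (\<lambda>u. - ray (1 / t) y + u) -` E"
    proof
      fix u assume "u \<in> ray (1 / t) ` cball y r"
      then obtain z where "z \<in> cball y r" and u: "u = ray (1 / t) z" by blast
      then have z: "dist z y \<le> r" by (simp add: dist_commute)
      have "norm (stretch t B (u - ray (1 / t) y)) \<le> (1 + \<epsilon>) * dist z y"
        using r0(2)[of z] z r by (simp add: u)
      also have "\<dots> \<le> (1 + \<epsilon>) * r" using z \<epsilon> by (intro mult_left_mono) auto
      finally show "u \<in> (\<lambda>u. - ray (1 / t) y + u) -` E" by (simp add: E_def)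
    qed
    moreover have "(\<lambda>u. - ray (1 / t) y + u) -` E \<in> sets borel"
      using measurable_sets[of "\<lambda>u. - ray (1 / t) y + u" borel borel E] E by auto
    ultimately have "emeasure lborel (ray (1 / t) ` cball y r) \<le>
        emeasure lborel ((\<lambda>u. - ray (1 / t) y + u) -` E)"
      by (intro emeasure_mono) auto
    also have "\<dots> = emeasure (distr lborel borel (\<lambda>u. - ray (1 / t) y + u)) E"
      using E by (subst emeasure_distr) auto
    also have "\<dots> = emeasure lborel E" by (simp only: lborel_distr_plus)
    also have "\<dots> = ennreal ((1 / t) ^ card B) * emeasure lborel (cball (0 :: real ^ 'n) ((1 + \<epsilon>) * r))"
      unfolding E_def using B t by (intro emeasure_stretch_vimage) auto
    also have "emeasure lborel (cball (0 :: real ^ 'n) ((1 + \<epsilon>) * r)) =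
        ennreal ((1 + \<epsilon>) ^ CARD('n)) * emeasure lborel (cball y r)"
      using r \<epsilon> by (simp add: emeasure_cball power_mult_distrib ennreal_mult'[symmetric] mult_ac unit_ball_vol_nonneg)
    also have "ennreal ((1 / t) ^ card B) * (ennreal ((1 + \<epsilon>) ^ CARD('n)) * emeasure lborel (cball y r)) =
        ennreal ((1 / t) ^ card B * (1 + \<epsilon>) ^ CARD('n)) * emeasure lborel (cball y r)"
      using t \<epsilon> by (subst ennreal_mult) (auto simp: mult.assoc)
    finally show "emeasure lborel (ray (1 / t) ` cball y r) \<le>
       ennreal ((1 / t) ^ card B * (1 + \<epsilon>) ^ CARD('n)) * emeasure lborel (cball y r)" .
  qed
qed

text \<open>
  By the covering theorem of Vitali, disjoint balls for which the preceding estimate holds exhaust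
  \<open>A\<close> up to a null set, and the contraction is Lipschitz, hence maps null sets to null sets. As
  the projection may fail to be differentiable, this covering argument stands in for the integration
  of the Jacobian determinant.
\<close>
lemma emeasure_ray_image_open_le:
  assumes normals: "\<And>y. y \<notin> K \<Longrightarrow> \<exists>B. normal_directions y B \<and> card B = k"
    and t: "1 \<le> t" and A: "open A" "A \<inter> K = {}"
  shows "emeasure lborel (ray (1 / t) ` A) \<le> ennreal ((1 / t) ^ k) * emeasure lborel A"
proof -
  have approx: "emeasure lborel (ray (1 / t) ` A) \<le> ennreal ((1 / t) ^ k * (1 + \<epsilon>) ^ CARD('n)) * emeasure lborel A"
    if \<epsilon>: "0 < \<epsilon>" for \<epsilon>
  proof -
    define c where "c = ennreal ((1 / t) ^ k * (1 + \<epsilon>) ^ CARD('n))"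
    define I where "I = {(y, r). 0 < r \<and> cball y r \<subseteq> A \<and>
      emeasure lborel (ray (1 / t) ` cball y r) \<le> c * emeasure lborel (cball y r)}"
    have fine: "\<exists>i. i \<in> I \<and> y \<in> cball (fst i) (snd i) \<and> snd i < d" if "y \<in> A" "0 < d" for y d
    proof -
      obtain r1 where r1: "0 < r1" "cball y r1 \<subseteq> A"
        using A(1) \<open>y \<in> A\<close> open_contains_cball by blast
      from \<open>y \<in> A\<close> A(2) have "y \<notin> K" by blast
      then obtain B where B: "normal_directions y B" "card B = k" using normals by blast
      obtain r0 where r0: "0 < r0"
        "\<And>r. 0 < r \<Longrightarrow> r \<le> r0 \<Longrightarrow> emeasure lborel (ray (1 / t) ` cball y r) \<le> c * emeasure lborel (cball y r)"
        using emeasure_ray_image_cball_le[OF B(1) t \<epsilon>] unfolding B(2) c_def by blast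
      define r where "r = min (min r0 r1) (d / 2)"
      have "0 < r" "r \<le> r0" "r \<le> r1" "r < d" using r0 r1 \<open>0 < d\<close> by (auto simp: r_def)
      moreover from this have "cball y r \<subseteq> A" using r1(2) subset_cball[of r r1 y] by blast
      ultimately have "(y, r) \<in> I" using r0(2) by (simp add: I_def)
      with \<open>0 < r\<close> \<open>r < d\<close> show ?thesis by (intro exI[of _ "(y, r)"]) simp
    qed
    have pos: "0 < snd i" if "i \<in> I" for i using that by (auto simp: I_def)
    obtain C where C: "countable C" "C \<subseteq> I"
      "pairwise (\<lambda>i j. disjnt (cball (fst i) (snd i)) (cball (fst j) (snd j))) C"
      "negligible (A - (\<Union>i\<in>C. cball (fst i) (snd i)))"
      by (rule Vitali_covering_theorem_cballs[of I snd A fst, OF pos fine])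
    define N where "N = A - (\<Union>i\<in>C. cball (fst i) (snd i))"
    \<comment> \<open>An enumeration of the disjoint balls, padded with empty sets to keep it disjoint.\<close>
    define X where "X n = (if n \<in> to_nat_on C ` C
      then cball (fst (from_nat_into C n)) (snd (from_nat_into C n)) else {})" for n
    have X_eq: "X (to_nat_on C i) = cball (fst i) (snd i)" if "i \<in> C" for i
      using that C(1) by (simp add: X_def)
    have UX: "(\<Union>n. X n) = (\<Union>i\<in>C. cball (fst i) (snd i))"
    proof (intro equalityI subsetI)
      fix x assume "x \<in> (\<Union>n. X n)"
      then obtain n where "x \<in> X n" by blast
      moreover from this obtain i where "i \<in> C" "n = to_nat_on C i"
        by (auto simp: X_def split: if_splits)
      ultimately show "x \<in> (\<Union>i\<in>C. cball (fst i) (snd i))" using X_eq by blast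
    next
      fix x assume "x \<in> (\<Union>i\<in>C. cball (fst i) (snd i))"
      then show "x \<in> (\<Union>n. X n)" using X_eq by blast
    qed
    have disj: "disjoint_family X"
      unfolding disjoint_family_on_def
    proof (intro ballI impI)
      fix m n :: nat assume "m \<noteq> n"
      show "X m \<inter> X n = {}"
      proof (cases "m \<in> to_nat_on C ` C \<and> n \<in> to_nat_on C ` C")
        case True
        then obtain i j where ij: "i \<in> C" "j \<in> C" "m = to_nat_on C i" "n = to_nat_on C j" by blast
        with \<open>m \<noteq> n\<close> have "i \<noteq> j" by blast
        with C(3) ij(1,2) have "disjnt (cball (fst i) (snd i)) (cball (fst j) (snd j))"
          unfolding pairwise_def by blast
        then show ?thesis unfolding ij(3,4) X_eq[OF ij(1)] X_eq[OF ij(2)] disjnt_def .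
      qed (auto simp: X_def)
    qed
    have X_borel: "X n \<in> sets borel" for n by (simp add: X_def)
    have X_image: "ray (1 / t) ` X n \<in> sets borel" for n
      by (auto simp: X_def intro!: borel_compact compact_continuous_image continuous_on_ray)
    have "cball (fst i) (snd i) \<subseteq> A" if "i \<in> C" for i
      using subsetD[OF C(2) that] by (simp add: I_def split: prod.splits)
    then have X_sub: "(\<Union>n. X n) \<subseteq> A" unfolding UX by blast
    have X_le: "emeasure lborel (ray (1 / t) ` X n) \<le> c * emeasure lborel (X n)" for n
    proof (cases "n \<in> to_nat_on C ` C")
      case True
      then obtain i where "i \<in> C" "n = to_nat_on C i" by blast
      with C(2) show ?thesis by (auto simp: X_eq I_def)
    qed (simp add: X_def)
    have "negligible (ray (1 / t) ` N)"
    proof (rule negligible_locally_Lipschitz_image)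
      show "negligible N" using C(4) by (simp add: N_def)
      fix x assume "x \<in> N"
      show "\<exists>T B. open T \<and> x \<in> T \<and> (\<forall>y\<in>N \<inter> T. norm (ray (1 / t) y - ray (1 / t) x) \<le> B * norm (y - x))"
        using t by (intro exI[of _ UNIV] exI[of _ 1]) (auto intro: ray_nonexpansive)
    qed simp
    then have "ray (1 / t) ` N \<in> null_sets lebesgue" by (simp add: negligible_iff_null_sets)
    then obtain N' where N': "N' \<in> null_sets lborel" "ray (1 / t) ` N \<subseteq> N'"
      by (auto simp: null_sets_completion_iff2)
    have "ray (1 / t) ` A \<subseteq> N' \<union> (\<Union>n. ray (1 / t) ` X n)"
      using N'(2) unfolding N_def UX[symmetric] by blast
    then have "emeasure lborel (ray (1 / t) ` A) \<le> emeasure lborel (N' \<union> (\<Union>n. ray (1 / t) ` X n))"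
      using N'(1) X_image by (intro emeasure_mono) auto
    also have "\<dots> \<le> emeasure lborel N' + emeasure lborel (\<Union>n. ray (1 / t) ` X n)"
      using N'(1) X_image by (intro emeasure_subadditive) auto
    also have "\<dots> = emeasure lborel (\<Union>n. ray (1 / t) ` X n)" using N'(1) by (simp add: null_setsD1)
    also have "\<dots> \<le> (\<Sum>n. emeasure lborel (ray (1 / t) ` X n))"
      using X_image by (intro emeasure_subadditive_countably) auto
    also have "\<dots> \<le> (\<Sum>n. c * emeasure lborel (X n))" by (intro suminf_le X_le) auto
    also have "\<dots> = c * emeasure lborel (\<Union>n. X n)"
      using disj X_borel by (simp add: suminf_emeasure image_subset_iff)
    also have "\<dots> \<le> c * emeasure lborel A"
      using A(1) X_sub by (intro mult_left_mono emeasure_mono) auto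
    finally show ?thesis by (simp add: c_def)
  qed
  show ?thesis
  proof (cases "emeasure lborel A = top")
    case True
    then show ?thesis using t by (auto simp: ennreal_mult_top)
  next
    case False
    let ?g = "\<lambda>\<epsilon>. emeasure lborel A * ennreal ((1 / t) ^ k * (1 + \<epsilon>) ^ CARD('n))"
    have "(?g \<longlongrightarrow> ?g 0) (at_right 0)"
    proof (rule ennreal_tendsto_cmult)
      show "((\<lambda>\<epsilon>. ennreal ((1 / t) ^ k * (1 + \<epsilon>) ^ CARD('n))) \<longlongrightarrow>
          ennreal ((1 / t) ^ k * (1 + 0) ^ CARD('n))) (at_right 0)"
        by (intro tendsto_intros)
    qed (use False in \<open>simp add: less_top\<close>)
    moreover have "\<forall>\<^sub>F \<epsilon> in at_right 0. emeasure lborel (ray (1 / t) ` A) \<le> ?g \<epsilon>"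
      using eventually_at_right_less[of "0::real"]
      by eventually_elim (use approx in \<open>simp add: mult.commute\<close>)
    ultimately have "emeasure lborel (ray (1 / t) ` A) \<le> ?g 0"
      by (rule tendsto_lowerbound) simp
    then show ?thesis by (simp add: mult.commute)
  qed
qed

text \<open>
  The estimate for open sets extends to Borel sets by outer regularity, and from there to integrals
  as a comparison of two measures.
\<close>
lemma nn_integral_ray_le:
  assumes normals: "\<And>y. y \<notin> K \<Longrightarrow> \<exists>B. normal_directions y B \<and> card B = k"
    and t: "1 \<le> t" and [measurable]: "f \<in> borel_measurable borel"
  shows "(\<integral>\<^sup>+x\<in>- K. f (ray t x) \<partial>lborel) \<le> ennreal ((1 / t) ^ k) * (\<integral>\<^sup>+x\<in>- K. f x \<partial>lborel)"
proof -
  let ?i = "\<lambda>x. indicator (- K) x :: ennreal" and ?c = "ennreal ((1 / t) ^ k)"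
  have K[measurable]: "K \<in> sets borel" "- K \<in> sets borel" using closed by auto
  define M where "M = distr (density lborel ?i) borel (ray t)"
  define M' where "M' = density lborel (\<lambda>x. ?c * ?i x)"
  have sets: "sets M = sets borel" "sets M' = sets borel" by (simp_all add: M_def M'_def)
  have M: "emeasure M A = emeasure lborel (- K \<inter> ray t -` A)" if [measurable]: "A \<in> sets borel" for A
  proof -
    have [measurable]: "ray t -` A \<in> sets borel"
      using measurable_sets[OF measurable_ray that] by simp
    have "emeasure M A = emeasure (density lborel ?i) (ray t -` A)"
      unfolding M_def by (subst emeasure_distr) auto
    also have "\<dots> = (\<integral>\<^sup>+x. ?i x * indicator (ray t -` A) x \<partial>lborel)"
      by (rule emeasure_density) auto
    also have "(\<lambda>x. ?i x * indicator (ray t -` A) x) = indicator (- K \<inter> ray t -` A)"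
      by (auto simp: indicator_def fun_eq_iff)
    also have "integral\<^sup>N lborel (indicator (- K \<inter> ray t -` A)) = emeasure lborel (- K \<inter> ray t -` A)"
      by (rule nn_integral_indicator) simp
    finally show ?thesis .
  qed
  have M': "emeasure M' A = ?c * emeasure lborel (A - K)" if [measurable]: "A \<in> sets borel" for A
  proof -
    have "emeasure M' A = (\<integral>\<^sup>+x. ?c * indicator (A - K) x \<partial>lborel)"
      unfolding M'_def by (subst emeasure_density) (auto intro!: nn_integral_cong simp: indicator_def)
    then show ?thesis by (simp add: nn_integral_cmult)
  qed
  have "emeasure M A \<le> emeasure M' A" if A: "A \<in> sets borel" for A
  proof (rule ennreal_le_epsilon)
    fix e :: real assume "0 < e"
    have AK: "A - K \<in> sets borel" using A by simp
    then have "A - K \<in> sets lebesgue" by simp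
    then obtain T where T: "open T" "A - K \<subseteq> T" "emeasure lebesgue (T - (A - K)) < ennreal e"
      using sets_lebesgue_outer_open[OF _ \<open>0 < e\<close>] by metis
    define T' where "T' = T - K"
    have T': "open T'" "T' \<inter> K = {}" using T(1) closed by (auto simp: T'_def)
    have "- K \<inter> ray t -` A \<subseteq> - K \<inter> ray t -` T'"
      using T(2) t by (auto simp: T'_def ray_outside)
    moreover have "- K \<inter> ray t -` T' \<in> sets borel"
      using measurable_sets[OF measurable_ray, of T' t] T'(1) by (auto intro!: borel_open)
    ultimately have "emeasure M A \<le> emeasure lborel (- K \<inter> ray t -` T')"
      unfolding M[OF A] by (intro emeasure_mono) auto
    also have "\<dots> = emeasure lborel (ray (1 / t) ` T')" using t T'(2) by (simp add: ray_image_eq)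
    also have "\<dots> \<le> ?c * emeasure lborel T'"
      using emeasure_ray_image_open_le[OF normals t T'] .
    also have "\<dots> \<le> ?c * (emeasure lborel (A - K) + ennreal e)"
    proof (intro mult_left_mono)
      have "emeasure lborel T' \<le> emeasure lborel ((A - K) \<union> (T - (A - K)))"
        using AK T(1) by (intro emeasure_mono) (auto simp: T'_def)
      also have "\<dots> \<le> emeasure lborel (A - K) + emeasure lborel (T - (A - K))"
        using AK T(1) by (intro emeasure_subadditive) auto
      also have "emeasure lborel (T - (A - K)) \<le> ennreal e"
        using T(1,3) AK by (simp add: less_imp_le)
      finally show "emeasure lborel T' \<le> emeasure lborel (A - K) + ennreal e" by (simp add: add_left_mono)
    qed simp
    also have "\<dots> = ?c * emeasure lborel (A - K) + ?c * ennreal e" by (rule distrib_left)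
    also have "?c * ennreal e \<le> 1 * ennreal e"
      using t by (intro mult_right_mono ennreal_le_1[THEN iffD2] power_le_one) auto
    finally show "emeasure M A \<le> emeasure M' A + ennreal e" unfolding M'[OF A] by (simp add: add_left_mono)
  qed
  moreover have "emeasure M A = 0 \<and> emeasure M' A = 0" if "A \<notin> sets borel" for A
    using that sets by (simp add: emeasure_notin_sets)
  ultimately have "emeasure M \<le> emeasure M'" unfolding le_fun_def by (metis order_refl)
  then have "M \<le> M'" using sets sets_eq_imp_space_eq[of M M'] by (simp add: le_measure_iff)
  then have "nn_integral M f \<le> nn_integral M' f" using sets by (intro nn_integral_mono_measure) auto
  moreover have "nn_integral M f = (\<integral>\<^sup>+x\<in>- K. f (ray t x) \<partial>lborel)"
    unfolding M_def by (subst nn_integral_distr) (auto simp: nn_integral_density mult.commute)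
  moreover have "nn_integral M' f = ?c * (\<integral>\<^sup>+x\<in>- K. f x \<partial>lborel)"
    unfolding M'_def by (simp add: nn_integral_density mult.assoc mult.commute[of "f _"] nn_integral_cmult)
  ultimately show ?thesis by simp
qed

end

section \<open>Weights and a one-dimensional inequality\<close>

text \<open>
  The logarithmic derivative of the weight lies between \<open>\<delta> / s\<close> and \<open>\<delta>' / s\<close>. In the case
  \<open>\<delta>' < \<delta>\<close> the integrated form of this rests on \<open>1 + t * s \<le> t * (1 + s)\<close>.
\<close>
lemma weight_scale:
  assumes "0 \<le> \<delta>" "0 \<le> \<delta>'" "1 \<le> t" "0 < s"
  shows "t powr min \<delta> \<delta>' * weight \<delta> \<delta>' s \<le> weight \<delta> \<delta>' (t * s)"
proof (cases "\<delta> \<le> \<delta>'")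
  case True
  have "(1 + s) powr (\<delta>' - \<delta>) \<le> (1 + t * s) powr (\<delta>' - \<delta>)"
    using True assms by (intro powr_mono2) (auto simp: mult_le_cancel_right1)
  then show ?thesis
    using True assms by (simp add: weight_def powr_mult mult.assoc mult_left_mono)
next
  case False
  have "(t * (1 + s)) powr (\<delta>' - \<delta>) \<le> (1 + t * s) powr (\<delta>' - \<delta>)"
    using False assms by (intro powr_mono2') (auto simp: algebra_simps intro: add_pos_pos)
  then have "(t * s) powr \<delta> * (t * (1 + s)) powr (\<delta>' - \<delta>) \<le> weight \<delta> \<delta>' (t * s)"
    unfolding weight_def by (intro mult_left_mono) auto
  moreover have "(t * s) powr \<delta> * (t * (1 + s)) powr (\<delta>' - \<delta>) =
      (t powr \<delta> * t powr (\<delta>' - \<delta>)) * weight \<delta> \<delta>' s"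
    using assms by (simp add: weight_def powr_mult mult_ac)
  moreover have "t powr \<delta> * t powr (\<delta>' - \<delta>) = t powr min \<delta> \<delta>'"
    using False by (simp add: powr_add[symmetric] min_def)
  ultimately show ?thesis by simp
qed

text \<open>
  The graph of \<open>z powr p\<close> lies above its tangent at \<open>M\<close>, a rearrangement of Young's inequality.
\<close>
lemma powr_tangent_le:
  fixes M p z :: real
  assumes p: "1 \<le> p" and "0 < M" "0 \<le> z"
  shows "p * M powr (p - 1) * z \<le> z powr p + (p - 1) * M powr p"
proof (cases "p = 1")
  case False
  with p have p1: "1 < p" by simp
  define q where "q = p / (p - 1)"
  have q: "1 < q" "1 / p + 1 / q = 1" "(p - 1) * q = p" using p1 by (auto simp: q_def field_simps)
  have "z * M powr (p - 1) \<le> z powr p / p + (M powr (p - 1)) powr q / q"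
    using assms p1 q by (intro Youngs_inequality) auto
  also have "(M powr (p - 1)) powr q = M powr p" by (simp add: powr_powr q)
  finally have "p * (z * M powr (p - 1)) \<le> p * (z powr p / p + M powr p / q)"
    using p1 by (intro mult_left_mono) auto
  also have "p * (z powr p / p + M powr p / q) = z powr p + (p - 1) * M powr p"
    using p1 by (simp add: q_def field_simps)
  finally show ?thesis by (simp add: mult_ac)
qed (use assms in simp)

lemma nn_integral_exponential:
  assumes "0 < a"
  shows "(\<integral>\<^sup>+s\<in>{0..}. ennreal (a * exp (- a * s)) \<partial>lborel) = 1"
proof -
  have "((\<lambda>s. - exp (- a * s)) \<longlongrightarrow> - 0) at_top"
    using assms by (intro tendsto_minus filterlim_compose[OF exp_at_bot] filterlim_tendsto_neg_mult_at_bot[OF tendsto_const _ filterlim_ident]) auto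
  then have "(\<integral>\<^sup>+s. ennreal (a * exp (- a * s)) * indicator {0..} s \<partial>lborel) = ennreal (- 0 - (- exp (- a * 0)))"
    using assms by (intro nn_integral_FTC_atLeast[where F = "\<lambda>s. - exp (- a * s)"])
      (auto intro!: derivative_eq_intros)
  then show ?thesis by simp
qed

text \<open>
  Jensen's inequality for the exponential distribution with rate \<open>a\<close> and the function
  \<open>exp (a * s) / a * v s\<close>, whose mean is the integral of \<open>v\<close>. Both integrals may
  be infinite, so the proof integrates the tangent inequality at the real number \<open>M\<close>.
\<close>
lemma jensen_exponential:
  fixes a p M :: real and v :: "real \<Rightarrow> real"
  assumes p: "1 \<le> p" and a: "0 < a" and M: "0 \<le> M"
    and [measurable]: "v \<in> borel_measurable borel" and v: "\<And>s. 0 \<le> v s"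
    and le: "ennreal M \<le> (\<integral>\<^sup>+s\<in>{0..}. ennreal (v s) \<partial>lborel)"
  shows "ennreal (M powr p) \<le>
    (\<integral>\<^sup>+s\<in>{0..}. ennreal (a * exp (- a * s) * (exp (a * s) / a * v s) powr p) \<partial>lborel)"
proof (cases "M = 0")
  case False
  with M have M: "0 < M" by simp
  let ?e = "\<lambda>s. a * exp (- a * s)" and ?z = "\<lambda>s. exp (a * s) / a * v s"
  let ?J = "\<integral>\<^sup>+s\<in>{0..}. ennreal (?e s * ?z s powr p) \<partial>lborel"
  have tangent: "p * M powr (p - 1) * v s \<le> ?e s * ?z s powr p + (p - 1) * M powr p * ?e s" for s
  proof -
    have "?e s * (p * M powr (p - 1) * ?z s) \<le> ?e s * (?z s powr p + (p - 1) * M powr p)"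
      using p M v a by (intro mult_left_mono powr_tangent_le) auto
    moreover have "?e s * ?z s = v s" using a by (simp add: exp_minus field_simps)
    then have "?e s * (p * M powr (p - 1) * ?z s) = p * M powr (p - 1) * v s"
      by (metis mult.assoc mult.commute)
    ultimately show ?thesis by (simp add: algebra_simps)
  qed
  have "p * M powr p = p * M powr (p - 1) * M"
    using M by (simp add: powr_diff)
  then have "ennreal (p * M powr p) = ennreal (p * M powr (p - 1) * M)" by (rule arg_cong)
  also have "\<dots> = ennreal (p * M powr (p - 1)) * ennreal M"
    using p M by (intro ennreal_mult) auto
  also have "\<dots> \<le> ennreal (p * M powr (p - 1)) * (\<integral>\<^sup>+s\<in>{0..}. ennreal (v s) \<partial>lborel)"
    by (intro mult_left_mono le) simp
  also have "\<dots> = (\<integral>\<^sup>+s\<in>{0..}. ennreal (p * M powr (p - 1) * v s) \<partial>lborel)"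
    using p v by (simp add: nn_integral_cmult[symmetric] ennreal_mult mult.assoc)
  also have "\<dots> \<le> (\<integral>\<^sup>+s\<in>{0..}. ennreal (?e s * ?z s powr p) + ennreal ((p - 1) * M powr p) * ennreal (?e s) \<partial>lborel)"
    using tangent p a
    by (intro nn_integral_mono mult_right_mono) (auto simp: ennreal_mult[symmetric] ennreal_plus[symmetric] intro!: ennreal_leI simp del: ennreal_plus)
  also have "\<dots> = ?J + ennreal ((p - 1) * M powr p) * (\<integral>\<^sup>+s\<in>{0..}. ennreal (?e s) \<partial>lborel)"
    by (simp add: distrib_right nn_integral_add nn_integral_cmult mult.assoc)
  also have "\<dots> = ?J + ennreal ((p - 1) * M powr p)"
    by (simp only: nn_integral_exponential[OF a] mult_1_right)
  finally have "ennreal (p * M powr p) \<le> ennreal ((p - 1) * M powr p) + ?J"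
    unfolding add.commute[of ?J] .
  moreover have "ennreal (p * M powr p) = ennreal ((p - 1) * M powr p) + ennreal (M powr p)"
  proof -
    have "0 \<le> (p - 1) * M powr p" using p by simp
    then have "ennreal ((p - 1) * M powr p + M powr p) = ennreal ((p - 1) * M powr p) + ennreal (M powr p)"
      by (rule ennreal_plus) simp
    moreover have "(p - 1) * M powr p + M powr p = p * M powr p" by (simp add: left_diff_distrib)
    ultimately show ?thesis by simp
  qed
  ultimately have "ennreal ((p - 1) * M powr p) + ennreal (M powr p) \<le> ennreal ((p - 1) * M powr p) + ?J"
    by (simp only:)
  then show ?thesis by (simp add: ennreal_add_left_cancel_le)
qed simp

lemma has_derivative_grad:
  fixes f :: "real ^ 'n \<Rightarrow> real"
  assumes "f differentiable (at x)"
  shows "(f has_derivative (\<lambda>h. grad f x \<bullet> h)) (at x)"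
proof -
  let ?D = "frechet_derivative f (at x)"
  have D: "(f has_derivative ?D) (at x)" using assms by (simp add: frechet_derivative_works)
  then have lin: "linear ?D" by (rule has_derivative_linear)
  have "?D h = grad f x \<bullet> h" for h
  proof -
    have "?D h = ?D (\<Sum>k\<in>UNIV. (h $ k) *\<^sub>R axis k 1)"
      using basis_expansion[of h] by (simp add: scalar_mult_eq_scaleR)
    also have "\<dots> = (\<Sum>k\<in>UNIV. (h $ k) * ?D (axis k 1))"
      by (simp add: linear_sum[OF lin] linear_cmul[OF lin])
    finally show ?thesis by (simp add: grad_def inner_vec_def mult.commute)
  qed
  then have "?D = (\<lambda>h. grad f x \<bullet> h)" by blast
  with D show ?thesis by simp
qed

context nonempty_closed_convex
begin

section \<open>The Hardy inequality\<close>

text \<open>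
  This is the distance to \<open>K\<close> times the derivative of \<open>\<phi>\<close> in the direction of the gradient of the
  distance, and the derivative of \<open>\<phi> (ray (exp s) x)\<close> with respect to \<open>s\<close> at the point
  \<open>y = ray (exp s) x\<close>. It is extended by \<open>0\<close> to \<open>K\<close> to make it Borel measurable on the whole space.
\<close>
definition radial_derivative :: "(real ^ 'n \<Rightarrow> real) \<Rightarrow> real ^ 'n \<Rightarrow> real" where
  "radial_derivative \<phi> y = indicator (- K) y * ((y - proj y) \<bullet> grad \<phi> y)"

lemma measurable_radial_derivative:
  assumes "continuous_on (- K) (grad \<phi>)"
  shows "radial_derivative \<phi> \<in> borel_measurable borel"
proof -
  have "(\<lambda>y. indicator (- K) y *\<^sub>R ((y - proj y) \<bullet> grad \<phi> y)) \<in> borel_measurable borel"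
    using closed assms by (intro borel_measurable_continuous_on_indicator continuous_intros continuous_on_proj) auto
  then show ?thesis by (simp add: radial_derivative_def[abs_def])
qed

text \<open>
  The fundamental theorem of calculus along the normal ray through \<open>x\<close>, which leaves the compact
  support of \<open>\<phi>\<close> after a finite time.
\<close>
lemma abs_le_nn_integral_radial_derivative:
  assumes \<phi>: "\<phi> \<in> C1_compact_support (- K)" and x: "x \<notin> K"
  shows "ennreal \<bar>\<phi> x\<bar> \<le> (\<integral>\<^sup>+s\<in>{0..}. ennreal \<bar>radial_derivative \<phi> (ray (exp s) x)\<bar> \<partial>lborel)"
proof -
  let ?S = "{x \<in> - K. \<phi> x \<noteq> 0}"
  have diff: "\<phi> differentiable (at y)" if "y \<notin> K" for y
    using \<phi> that by (simp add: C1_compact_support_def)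
  have cont: "continuous_on (- K) (grad \<phi>)" using \<phi> by (simp add: C1_compact_support_def)
  have "bounded ?S"
    using \<phi> bounded_subset[OF compact_imp_bounded closure_subset] by (simp add: C1_compact_support_def)
  then obtain R where R: "\<And>y. y \<notin> K \<Longrightarrow> \<phi> y \<noteq> 0 \<Longrightarrow> norm y \<le> R"
    by (auto simp: bounded_iff)
  have out: "ray (exp s) x \<notin> K" for s using x by (simp add: ray_outside)
  define D where "D = norm (x - proj x)"
  have D: "0 < D" using x outside_iff infdist_eq_norm by (simp add: D_def)
  define s1 where "s1 = max 0 ((R + norm (proj x)) / D)"
  have vanish: "\<phi> (ray (exp s1) x) = 0"
  proof (rule ccontr)
    assume "\<phi> (ray (exp s1) x) \<noteq> 0"
    then have "norm (ray (exp s1) x) \<le> R" using R out by blast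
    moreover have "exp s1 * D = norm (ray (exp s1) x - proj x)" by (simp add: ray_def D_def)
    then have "exp s1 * D \<le> norm (ray (exp s1) x) + norm (proj x)"
      using norm_triangle_ineq4[of "ray (exp s1) x" "proj x"] by simp
    ultimately have "exp s1 \<le> (R + norm (proj x)) / D" using D by (simp add: field_simps)
    also have "\<dots> \<le> s1" by (simp add: s1_def)
    also have "s1 < exp s1" using exp_ge_add_one_self[of s1] by linarith
    finally show False by simp
  qed
  let ?u = "\<lambda>s. \<phi> (ray (exp s) x)" and ?u' = "\<lambda>s. radial_derivative \<phi> (ray (exp s) x)"
  have u'_eq: "?u' s = (exp s *\<^sub>R (x - proj x)) \<bullet> grad \<phi> (ray (exp s) x)" for s
    using out[of s] by (simp add: radial_derivative_def proj_ray) (simp add: ray_def)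
  have deriv: "(?u has_vector_derivative ?u' s) (at s within {0..s1})" for s
  proof -
    have "((\<lambda>s. ray (exp s) x) has_derivative (\<lambda>h. (h * exp s) *\<^sub>R (x - proj x))) (at s within {0..s1})"
      unfolding ray_def by (auto intro!: derivative_eq_intros)
    moreover have "(\<phi> has_derivative (\<lambda>h. grad \<phi> (ray (exp s) x) \<bullet> h)) (at (ray (exp s) x))"
      using has_derivative_grad diff out by blast
    ultimately have "(?u has_derivative (\<lambda>h. grad \<phi> (ray (exp s) x) \<bullet> ((h * exp s) *\<^sub>R (x - proj x)))) (at s within {0..s1})"
      by (rule has_derivative_compose)
    then show ?thesis
      unfolding has_vector_derivative_def u'_eq by (simp add: inner_commute mult.assoc)
  qed
  have "continuous_on {0..s1} ?u'"
    unfolding u'_eq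
    by (intro continuous_intros continuous_on_compose2[OF cont])
       (use out in \<open>auto simp: ray_def intro!: continuous_intros\<close>)
  then have "has_bochner_integral lborel (\<lambda>s. indicator {0..s1} s *\<^sub>R ?u' s) (?u s1 - ?u 0)"
    by (intro has_bochner_integral_FTC_Icc deriv) (simp_all add: s1_def)
  then have int: "integrable lborel (\<lambda>s. indicator {0..s1} s *\<^sub>R ?u' s)"
    "(\<integral>s. indicator {0..s1} s *\<^sub>R ?u' s \<partial>lborel) = - \<phi> x"
    by (auto simp: has_bochner_integral_iff vanish)
  have "ennreal \<bar>\<phi> x\<bar> \<le> (\<integral>\<^sup>+s. norm (indicator {0..s1} s *\<^sub>R ?u' s) \<partial>lborel)"
    using integral_norm_bound_ennreal[OF int(1)] unfolding int(2) by simp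
  also have "\<dots> \<le> (\<integral>\<^sup>+s\<in>{0..}. ennreal \<bar>?u' s\<bar> \<partial>lborel)"
    by (intro nn_integral_mono) (auto simp: indicator_def)
  finally show ?thesis .
qed

text \<open>
  Three exponential factors have to balance along the rays: \<open>jensen_exponential\<close> costs
  \<open>exp (a * p * s)\<close>, comparing the density \<open>\<omega>\<close> at \<open>x\<close> and at \<open>ray (exp s) x\<close> costs
  \<open>exp ((p - min \<delta> \<delta>') * s)\<close>, and the change of variables gains \<open>exp (- (k * s))\<close>. The hypothesis
  on \<open>a\<close> says that their product is at most \<open>1\<close>, so up to the constant \<open>(1 / a) powr p\<close> the integral
  over \<open>s\<close> is the total mass of the exponential distribution.
\<close>
lemma radial_hardy:
  assumes normals: "\<And>y. y \<notin> K \<Longrightarrow> \<exists>B. normal_directions y B \<and> card B = k"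
    and \<phi>: "\<phi> \<in> C1_compact_support (- K)"
    and \<delta>: "0 \<le> \<delta>" "0 \<le> \<delta>'" and p: "1 \<le> p"
    and a: "0 < a" "a * p \<le> real k + min \<delta> \<delta>' - p"
  shows "ennreal (a powr p) *
      (\<integral>\<^sup>+x\<in>- K. ennreal (weight \<delta> \<delta>' (infdist x K) * infdist x K powr (- p) * \<bar>\<phi> x\<bar> powr p) \<partial>lborel)
    \<le> (\<integral>\<^sup>+x\<in>- K. ennreal (weight \<delta> \<delta>' (infdist x K) * infdist x K powr (- p) *
          \<bar>radial_derivative \<phi> x\<bar> powr p) \<partial>lborel)"
proof -
  let ?m = "min \<delta> \<delta>'"
  define \<omega> where "\<omega> x = weight \<delta> \<delta>' (infdist x K) * infdist x K powr (- p)" for x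
  define G where "G = radial_derivative \<phi>"
  define W where "W x = \<omega> x * \<bar>G x\<bar> powr p" for x
  define c where "c = a * (1 / a) powr p"
  have c: "0 < c" using a by (simp add: c_def)
  have \<omega>_nonneg: "0 \<le> \<omega> x" for x by (simp add: \<omega>_def weight_def)
  have W_nonneg: "0 \<le> W x" for x by (simp add: W_def \<omega>_nonneg)
  have cont: "continuous_on (- K) (grad \<phi>)" using \<phi> by (simp add: C1_compact_support_def)
  have G[measurable]: "G \<in> borel_measurable borel"
    unfolding G_def using cont by (rule measurable_radial_derivative)
  have [measurable]: "(\<lambda>x. infdist x K) \<in> borel_measurable borel"
    by (intro borel_measurable_continuous_onI continuous_intros)
  have W[measurable]: "W \<in> borel_measurable borel"
    unfolding W_def[abs_def] \<omega>_def weight_def by measurable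
  have [measurable]: "proj \<in> borel_measurable borel"
    by (intro borel_measurable_continuous_onI continuous_on_proj)
  have ray2[measurable]: "(\<lambda>(x, s). ray (exp s) x) \<in> borel_measurable (lborel \<Otimes>\<^sub>M lborel)"
    unfolding ray_def by measurable
  have [measurable]: "- K \<in> sets borel" using closed by auto
  have scale: "\<omega> x \<le> exp (s * (p - ?m)) * \<omega> (ray (exp s) x)" if "x \<notin> K" "0 \<le> s" for x s
  proof -
    define D where "D = infdist x K"
    have D: "0 < D" using that outside_iff by (simp add: D_def)
    have "exp s powr ?m * weight \<delta> \<delta>' D \<le> weight \<delta> \<delta>' (exp s * D)"
      using \<delta> D that by (intro weight_scale) auto
    then have "exp s powr ?m * weight \<delta> \<delta>' D * (exp s * D) powr (- p) \<le> \<omega> (ray (exp s) x)"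
      unfolding \<omega>_def by (simp add: infdist_ray D_def mult_right_mono)
    moreover have "exp s powr ?m * weight \<delta> \<delta>' D * (exp s * D) powr (- p) =
        (exp s powr ?m * exp s powr (- p)) * \<omega> x"
      using D by (simp add: \<omega>_def D_def powr_mult mult_ac)
    ultimately have "(exp s powr ?m * exp s powr (- p)) * \<omega> x \<le> \<omega> (ray (exp s) x)" by simp
    then have "exp (s * (?m - p)) * \<omega> x \<le> \<omega> (ray (exp s) x)"
      by (simp add: powr_def algebra_simps flip: exp_add)
    then have "exp (s * (p - ?m)) * (exp (s * (?m - p)) * \<omega> x) \<le> exp (s * (p - ?m)) * \<omega> (ray (exp s) x)"
      by (intro mult_left_mono) auto
    moreover have "exp (s * (p - ?m)) * (exp (s * (?m - p)) * \<omega> x) = \<omega> x"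
      unfolding mult.assoc[symmetric] exp_add[symmetric] by (simp add: algebra_simps)
    ultimately show ?thesis by simp
  qed
  have pointwise: "ennreal (\<omega> x * \<bar>\<phi> x\<bar> powr p) \<le>
      (\<integral>\<^sup>+s\<in>{0..}. ennreal (c * exp (- a * s) * exp (s * k) * W (ray (exp s) x)) \<partial>lborel)" if x: "x \<notin> K" for x
  proof -
    let ?v = "\<lambda>s. \<bar>G (ray (exp s) x)\<bar>"
    have v[measurable]: "?v \<in> borel_measurable borel"
      unfolding ray_def by measurable
    have "ennreal (\<omega> x * \<bar>\<phi> x\<bar> powr p) = ennreal (\<omega> x) * ennreal (\<bar>\<phi> x\<bar> powr p)"
      by (simp add: ennreal_mult \<omega>_nonneg)
    also have "\<dots> \<le> ennreal (\<omega> x) * (\<integral>\<^sup>+s\<in>{0..}. ennreal (a * exp (- a * s) * (exp (a * s) / a * ?v s) powr p) \<partial>lborel)"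
      using p a abs_le_nn_integral_radial_derivative[OF \<phi> x] v
      by (intro mult_left_mono jensen_exponential) (auto simp: G_def)
    also have "\<dots> = (\<integral>\<^sup>+s\<in>{0..}. ennreal (\<omega> x * (a * exp (- a * s) * (exp (a * s) / a * ?v s) powr p)) \<partial>lborel)"
      using a by (simp add: nn_integral_cmult[symmetric] ennreal_mult \<omega>_nonneg mult.assoc)
    also have "\<dots> \<le> (\<integral>\<^sup>+s\<in>{0..}. ennreal (c * exp (- a * s) * exp (s * k) * W (ray (exp s) x)) \<partial>lborel)"
    proof (intro nn_integral_mono)
      fix s :: real
      have "\<omega> x * (a * exp (- a * s) * (exp (a * s) / a * ?v s) powr p) \<le>
          c * exp (- a * s) * exp (s * k) * W (ray (exp s) x)" if s: "0 \<le> s"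
      proof -
        have "(exp (a * s) / a * ?v s) powr p = (1 / a) powr p * exp (s * (a * p)) * ?v s powr p"
          using a powr_mult[of "1 / a" "exp (a * s)" p] powr_mult[of "exp (a * s) / a" "?v s" p]
          by (simp add: powr_def[of "exp _"] mult_ac)
        then have "\<omega> x * (a * exp (- a * s) * (exp (a * s) / a * ?v s) powr p) =
            c * exp (- a * s) * (\<omega> x * exp (s * (a * p)) * ?v s powr p)"
          by (simp add: c_def mult_ac)
        also have "\<dots> \<le> c * exp (- a * s) * (exp (s * k) * W (ray (exp s) x))"
        proof (intro mult_left_mono)
          have "\<omega> x * exp (s * (a * p)) \<le> exp (s * (p - ?m)) * \<omega> (ray (exp s) x) * exp (s * (a * p))"
            using scale[OF x s] by (intro mult_right_mono) auto
          also have "\<dots> = exp (s * (p - ?m) + s * (a * p)) * \<omega> (ray (exp s) x)"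
            by (simp add: exp_add mult_ac)
          also have "\<dots> \<le> exp (s * k) * \<omega> (ray (exp s) x)"
          proof -
            have "s * (p - ?m) + s * (a * p) = s * (p - ?m + a * p)" by (simp add: distrib_left)
            also have "\<dots> \<le> s * k" using a(2) s by (intro mult_left_mono) auto
            finally show ?thesis by (intro mult_right_mono \<omega>_nonneg) simp
          qed
          finally show "\<omega> x * exp (s * (a * p)) * ?v s powr p \<le> exp (s * k) * W (ray (exp s) x)"
            unfolding W_def mult.assoc[symmetric] by (intro mult_right_mono) auto
        qed (use c in auto)
        finally show ?thesis by (simp add: mult.assoc)
      qed
      then show "ennreal (\<omega> x * (a * exp (- a * s) * (exp (a * s) / a * ?v s) powr p)) * indicator {0..} s \<le>
          ennreal (c * exp (- a * s) * exp (s * k) * W (ray (exp s) x)) * indicator {0..} s"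
        by (auto simp: indicator_def intro!: ennreal_leI)
    qed
    finally show ?thesis .
  qed
  let ?I = "\<integral>\<^sup>+x\<in>- K. ennreal (W x) \<partial>lborel"
  let ?f = "\<lambda>s. ennreal (c * exp (- a * s) * exp (s * k)) * indicator {0..} s"
  have W2[measurable]: "(\<lambda>(x, s). ennreal (W (ray (exp s) x))) \<in> borel_measurable (lborel \<Otimes>\<^sub>M lborel)"
    using measurable_compose[OF ray2, of "\<lambda>y. ennreal (W y)" borel] by (simp add: split_beta')
  have "(\<integral>\<^sup>+x\<in>- K. ennreal (\<omega> x * \<bar>\<phi> x\<bar> powr p) \<partial>lborel) \<le>
      (\<integral>\<^sup>+x. (\<integral>\<^sup>+s. ?f s * (ennreal (W (ray (exp s) x)) * indicator (- K) x) \<partial>lborel) \<partial>lborel)"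
  proof (intro nn_integral_mono)
    fix x
    show "ennreal (\<omega> x * \<bar>\<phi> x\<bar> powr p) * indicator (- K) x \<le>
        (\<integral>\<^sup>+s. ?f s * (ennreal (W (ray (exp s) x)) * indicator (- K) x) \<partial>lborel)"
    proof (cases "x \<in> K")
      case False
      have "(\<integral>\<^sup>+s\<in>{0..}. ennreal (c * exp (- a * s) * exp (s * k) * W (ray (exp s) x)) \<partial>lborel) =
          (\<integral>\<^sup>+s. ?f s * (ennreal (W (ray (exp s) x)) * indicator (- K) x) \<partial>lborel)"
        using False c by (intro nn_integral_cong) (simp add: ennreal_mult W_nonneg mult_ac)
      with pointwise[OF False] False show ?thesis by simp
    qed simp
  qed
  also have "\<dots> = (\<integral>\<^sup>+s. (\<integral>\<^sup>+x. ?f s * (ennreal (W (ray (exp s) x)) * indicator (- K) x) \<partial>lborel) \<partial>lborel)"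
    by (rule lborel_pair.Fubini'[symmetric]) measurable
  also have "\<dots> = (\<integral>\<^sup>+s. ?f s * (\<integral>\<^sup>+x\<in>- K. ennreal (W (ray (exp s) x)) \<partial>lborel) \<partial>lborel)"
    by (intro nn_integral_cong nn_integral_cmult) measurable
  also have "\<dots> \<le> (\<integral>\<^sup>+s. ennreal (c / a) * ?I * (ennreal (a * exp (- a * s)) * indicator {0..} s) \<partial>lborel)"
  proof (intro nn_integral_mono)
    fix s :: real
    show "?f s * (\<integral>\<^sup>+x\<in>- K. ennreal (W (ray (exp s) x)) \<partial>lborel) \<le>
        ennreal (c / a) * ?I * (ennreal (a * exp (- a * s)) * indicator {0..} s)"
    proof (cases "0 \<le> s")
      case True
      have "(\<integral>\<^sup>+x\<in>- K. ennreal (W (ray (exp s) x)) \<partial>lborel) \<le> ennreal ((1 / exp s) ^ k) * ?I"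
        using True by (intro nn_integral_ray_le normals) auto
      then have "?f s * (\<integral>\<^sup>+x\<in>- K. ennreal (W (ray (exp s) x)) \<partial>lborel) \<le>
          ennreal (c * exp (- a * s) * exp (s * k)) * (ennreal ((1 / exp s) ^ k) * ?I)"
        using True by (simp add: mult_left_mono)
      also have "\<dots> = ennreal (c * exp (- a * s) * exp (s * k) * (1 / exp s) ^ k) * ?I"
        using c by (simp add: ennreal_mult mult.assoc)
      also have "c * exp (- a * s) * exp (s * k) * (1 / exp s) ^ k = c / a * (a * exp (- a * s))"
        using a by (simp add: exp_of_nat2_mult power_divide)
      also have "ennreal (c / a * (a * exp (- a * s))) = ennreal (c / a) * ennreal (a * exp (- a * s))"
        using a c by (intro ennreal_mult) auto
      finally show ?thesis using True by (simp add: mult_ac)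
    qed simp
  qed
  also have "\<dots> = ennreal (c / a) * ?I * (\<integral>\<^sup>+s\<in>{0..}. ennreal (a * exp (- a * s)) \<partial>lborel)"
    by (rule nn_integral_cmult) measurable
  also have "\<dots> = ennreal (c / a) * ?I" by (simp only: nn_integral_exponential[OF a(1)] mult_1_right)
  finally have "ennreal (a powr p) * (\<integral>\<^sup>+x\<in>- K. ennreal (\<omega> x * \<bar>\<phi> x\<bar> powr p) \<partial>lborel) \<le>
      ennreal (a powr p) * (ennreal (c / a) * ?I)" by (rule mult_left_mono) simp
  also have "\<dots> = ennreal (a powr p * (c / a)) * ?I"
    by (subst ennreal_mult) (use a c in \<open>simp_all add: mult.assoc\<close>)
  also have "a powr p * (c / a) = 1"
    using a powr_mult[of a "1 / a" p] by (simp add: c_def)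
  finally show ?thesis by (simp add: \<omega>_def W_def G_def)
qed

text \<open>
  The number of normal directions matches the codimension of the boundary: all directions orthogonal
  to the affine hull when \<open>K\<close> has empty interior, so that it is its own frontier, and
  the direction of the gradient of the distance otherwise.
\<close>
lemma normal_directions_codimension:
  assumes "K \<noteq> UNIV"
  obtains k where "real CARD('n) - hausdorff_dim (frontier K) \<le> real k"
    "\<And>y. y \<notin> K \<Longrightarrow> \<exists>B. normal_directions y B \<and> card B = k"
proof (cases "aff_dim K = int CARD('n)")
  case True
  then have "affine hull K = UNIV" using aff_dim_eq_full[of K] by simp
  then have "interior K \<noteq> {}"
    using nonempty convex rel_interior_interior[of K] rel_interior_eq_empty[of K] by auto
  then have "real CARD('n) - 1 \<le> hausdorff_dim (frontier K)"
    using hausdorff_dim_frontier_convex_body[OF closed convex] assms by simp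
  then show ?thesis
    using that[of 1] normal_directions_gradient by (metis card_1_singleton_iff diff_le_eq add.commute of_nat_1 One_nat_def)
next
  case False
  then have "interior K = {}" by (intro low_dim_interior) simp
  then have fr: "frontier K = K" using closed by (simp add: frontier_def)
  have "0 \<le> aff_dim K" using nonempty aff_dim_empty[of K] aff_dim_geq[of K] by linarith
  then obtain m where m: "aff_dim K = int m" using nonneg_int_cases by metis
  have mle: "m \<le> CARD('n)" using aff_dim_le_DIM[of K] m by simp
  obtain B where B: "card B = nat (int CARD('n) - aff_dim K)" "\<And>y. normal_directions y B"
    using normal_directions_flat by blast
  have "card B = CARD('n) - m" using B(1) m by (simp add: nat_diff_distrib)
  moreover have "real m \<le> hausdorff_dim K" using hausdorff_dim_convex_lower_bound[OF convex m] .
  ultimately have "real CARD('n) - hausdorff_dim (frontier K) \<le> real (card B)"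
    using mle fr by (simp add: of_nat_diff)
  then show ?thesis using that[of "card B"] B(2) by blast
qed

end

theorem theorem1p1:
  fixes K \<Omega> :: "(real ^ 'n) set"
    and \<delta> \<delta>' p d d\<^sub>H a\<^sub>p :: real
    and d\<^sub>\<Gamma> c\<^sub>\<Omega> \<phi> :: "real ^ 'n \<Rightarrow> real"
  assumes "K \<noteq> {}" and "closed K" and "convex K" and "K \<noteq> UNIV"
    and "\<Omega> = UNIV - K"
    and "d = real CARD('n)"
    and "d\<^sub>H = hausdorff_dim (frontier \<Omega>)"
    and "d\<^sub>\<Gamma> = boundary_dist \<Omega>"
    and "\<delta> \<ge> 0" and "\<delta>' \<ge> 0"
    and "c\<^sub>\<Omega> = weight \<delta> \<delta>' \<circ> d\<^sub>\<Gamma>"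
    and "p \<ge> 1"
    and "d - d\<^sub>H + min \<delta> \<delta>' - p > 0"
    and "a\<^sub>p = (d - d\<^sub>H + min \<delta> \<delta>' - p) / p"
    and "\<phi> \<in> C1_compact_support \<Omega>"
  shows "(\<integral>\<^sup>+x\<in>\<Omega>. ennreal (c\<^sub>\<Omega> x * norm (grad \<phi> x) powr p) \<partial>lborel)
           \<ge> (\<integral>\<^sup>+x\<in>\<Omega>. ennreal (c\<^sub>\<Omega> x * \<bar>grad d\<^sub>\<Gamma> x \<bullet> grad \<phi> x\<bar> powr p) \<partial>lborel) \<and>
         (\<integral>\<^sup>+x\<in>\<Omega>. ennreal (c\<^sub>\<Omega> x * \<bar>grad d\<^sub>\<Gamma> x \<bullet> grad \<phi> x\<bar> powr p) \<partial>lborel)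
           \<ge> ennreal (a\<^sub>p powr p) *
              (\<integral>\<^sup>+x\<in>\<Omega>. ennreal (c\<^sub>\<Omega> x * d\<^sub>\<Gamma> x powr (- p) * \<bar>\<phi> x\<bar> powr p) \<partial>lborel)"
proof
  interpret nonempty_closed_convex K using assms(1-3) by unfold_locales
  have \<Omega>: "\<Omega> = - K" using assms(5) by auto
  have d\<Gamma>: "d\<^sub>\<Gamma> = (\<lambda>x. infdist x K)"
    unfolding assms(8) \<Omega> by (auto simp: boundary_dist_def double_diff Compl_eq_Diff_UNIV)
  have grad_d: "grad d\<^sub>\<Gamma> x = sgn (x - proj x)" if "x \<in> \<Omega>" for x
    using grad_boundary_dist[of x] that unfolding assms(5,8) by simp
  have c\<Omega>: "c\<^sub>\<Omega> x = weight \<delta> \<delta>' (infdist x K)" "0 \<le> c\<^sub>\<Omega> x" for x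
    unfolding assms(11) d\<Gamma> by (simp_all add: weight_def)
  show "(\<integral>\<^sup>+x\<in>\<Omega>. ennreal (c\<^sub>\<Omega> x * \<bar>grad d\<^sub>\<Gamma> x \<bullet> grad \<phi> x\<bar> powr p) \<partial>lborel) \<le>
      (\<integral>\<^sup>+x\<in>\<Omega>. ennreal (c\<^sub>\<Omega> x * norm (grad \<phi> x) powr p) \<partial>lborel)"
  proof (intro nn_integral_mono)
    fix x
    have "c\<^sub>\<Omega> x * \<bar>grad d\<^sub>\<Gamma> x \<bullet> grad \<phi> x\<bar> powr p \<le> c\<^sub>\<Omega> x * norm (grad \<phi> x) powr p" if "x \<in> \<Omega>"
    proof -
      have "\<bar>grad d\<^sub>\<Gamma> x \<bullet> grad \<phi> x\<bar> \<le> norm (grad d\<^sub>\<Gamma> x) * norm (grad \<phi> x)"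
        by (rule Cauchy_Schwarz_ineq2)
      also have "\<dots> \<le> 1 * norm (grad \<phi> x)"
        unfolding grad_d[OF that] by (intro mult_right_mono) (auto simp: norm_sgn)
      finally show ?thesis using assms(12) c\<Omega>(2) by (intro mult_left_mono powr_mono2) auto
    qed
    then show "ennreal (c\<^sub>\<Omega> x * \<bar>grad d\<^sub>\<Gamma> x \<bullet> grad \<phi> x\<bar> powr p) * indicator \<Omega> x \<le>
        ennreal (c\<^sub>\<Omega> x * norm (grad \<phi> x) powr p) * indicator \<Omega> x"
      by (auto simp: indicator_def intro!: ennreal_leI)
  qed
  obtain k where k: "real CARD('n) - hausdorff_dim (frontier K) \<le> real k"
    "\<And>y. y \<notin> K \<Longrightarrow> \<exists>B. normal_directions y B \<and> card B = k"
    using normal_directions_codimension[OF assms(4)] by blast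
  have a: "0 < a\<^sub>p" "a\<^sub>p * p \<le> real k + min \<delta> \<delta>' - p"
    using assms(12,13) k(1) unfolding assms(14) assms(6,7) \<Omega> frontier_complement by auto
  have radial: "c\<^sub>\<Omega> x * infdist x K powr (- p) * \<bar>radial_derivative \<phi> x\<bar> powr p =
      c\<^sub>\<Omega> x * \<bar>grad d\<^sub>\<Gamma> x \<bullet> grad \<phi> x\<bar> powr p" if "x \<in> \<Omega>" for x
  proof -
    have D: "0 < infdist x K" using that outside_iff by (simp add: \<Omega>)
    have "x - proj x = infdist x K *\<^sub>R sgn (x - proj x)"
      using D by (simp add: sgn_div_norm infdist_eq_norm)
    then have "radial_derivative \<phi> x = infdist x K * (grad d\<^sub>\<Gamma> x \<bullet> grad \<phi> x)"
      using that unfolding radial_derivative_def grad_d[OF that] by (metis \<Omega> indicator_simps(1) inner_scaleR_left mult_1)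
    then have "\<bar>radial_derivative \<phi> x\<bar> powr p = infdist x K powr p * \<bar>grad d\<^sub>\<Gamma> x \<bullet> grad \<phi> x\<bar> powr p"
      using D by (simp add: abs_mult powr_mult)
    then show ?thesis using D by (simp add: powr_minus field_simps)
  qed
  have "ennreal (a\<^sub>p powr p) * (\<integral>\<^sup>+x\<in>\<Omega>. ennreal (c\<^sub>\<Omega> x * d\<^sub>\<Gamma> x powr (- p) * \<bar>\<phi> x\<bar> powr p) \<partial>lborel) \<le>
      (\<integral>\<^sup>+x\<in>\<Omega>. ennreal (c\<^sub>\<Omega> x * infdist x K powr (- p) * \<bar>radial_derivative \<phi> x\<bar> powr p) \<partial>lborel)"
    unfolding d\<Gamma> c\<Omega>(1) \<Omega>
    using assms(9,10,12,15) a k(2) by (intro radial_hardy) (auto simp: \<Omega>)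
  also have "\<dots> = (\<integral>\<^sup>+x\<in>\<Omega>. ennreal (c\<^sub>\<Omega> x * \<bar>grad d\<^sub>\<Gamma> x \<bullet> grad \<phi> x\<bar> powr p) \<partial>lborel)"
  proof (intro nn_integral_cong)
    fix x
    show "ennreal (c\<^sub>\<Omega> x * infdist x K powr (- p) * \<bar>radial_derivative \<phi> x\<bar> powr p) * indicator \<Omega> x =
        ennreal (c\<^sub>\<Omega> x * \<bar>grad d\<^sub>\<Gamma> x \<bullet> grad \<phi> x\<bar> powr p) * indicator \<Omega> x"
      by (cases "x \<in> \<Omega>") (simp only: radial, simp)
  qed
  finally show "ennreal (a\<^sub>p powr p) * (\<integral>\<^sup>+x\<in>\<Omega>. ennreal (c\<^sub>\<Omega> x * d\<^sub>\<Gamma> x powr (- p) * \<bar>\<phi> x\<bar> powr p) \<partial>lborel) \<le>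
      (\<integral>\<^sup>+x\<in>\<Omega>. ennreal (c\<^sub>\<Omega> x * \<bar>grad d\<^sub>\<Gamma> x \<bullet> grad \<phi> x\<bar> powr p) \<partial>lborel)" .
qed

end
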